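(* Let $(\Omega,\mathcal{F},\mu)$ be a separable $\sigma$-finite non-atomic measure space and let $(I,\mathcal{B}_m,m)$ be the corresponding standard measure space. Then there exists an algebraic, order, topological and integral preserving isomorphism $$\Phi\colon\mathbf{L}_0(\Omega,\mathcal{F},\mu)\to\mathbf{L}_0(I,\mathcal{B}_m,m)$$ such that for every symmetric space $\mathbf{E}(\Omega,\mathcal{F},\mu)\subset\mathbf{L}_0(\Omega,\mathcal{F},\mu)$ the restriction $\Phi_{\mathbf{E}}=\Phi|_{\mathbf{E}(\Omega,\mathcal{F},\mu)}$ is an isometric isomorphism between the symmetric space $\mathbf{E}(\Omega,\mathcal{F},\mu)$ and its equimeasurable standard symmetric space $\mathbf{E}(I,\mathcal{B}_m,m)$.
   Context: All measure spaces $(\Omega,\mathcal{F},\mu)$ are assumed $\mu$-complete, with finite or infinite $\sigma$-finite non-atomic measure $\mu$, $\mu(\Omega)>0$. $(\Omega,\mathcal{F},\mu)$ is separable if there is a countable subalgebra $\mathcal{A}\subseteq\mathcal{F}$ such that $\mathcal{F}$ is contained in the $\mu$-completion of the $\sigma$-algebra generated by $\mathcal{A}$. The standard measure space corresponding to $(\Omega,\mathcal{F},\mu)$ is $(I,\mathcal{B}_m,m)$, where $I=[0,\infty)$ if $\mu(\Omega)=\infty$ and $I=[0,a]$ if $\mu(\Omega)=a<\infty$, $m$ is Lebesgue measure and $\mathcal{B}_m$ is the $m$-completion of the Borel $\sigma$-algebra of $I$. $\mathbf{L}_0(\Omega,\mathcal{F},\mu)$ is the space of $\mu$-a.e. equivalence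 classes of measurable functions $f\colon\Omega\to\mathbb{R}$; it is an algebra over $\mathbb{R}$, a lattice under the a.e. order, and carries the (metrizable) topology of convergence in measure on sets of finite measure. "Algebraic, order, topological and integral preserving isomorphism" means a bijection that is an isomorphism of real algebras, an order isomorphism, a homeomorphism, and satisfies $\int_I\Phi(f)\,dm=\int_\Omega f\,d\mu\in[0,\infty]$ for all $f\ge 0$. For $f\in\mathbf{L}_0(\Omega,\mathcal{F},\mu)$ put $\eta_{f,\mu}(x)=\mu(\{|f|>x\})$ and $\xi_{f,\mu}(x)=\inf\{y\in[0,\infty):\eta_{f,\mu}(y)\le x\}$, $x\ge0$ (with $\inf\emptyset=+\infty$). A symmetric space on $(\Omega,\mathcal{F},\mu)$ is a non-zero Banach or quasi-Banach space $(\mathbf{E},\|\cdot\|_{\mathbf{E}})$ which is a linear subspace of $\mathbf{L}_0(\Omega,\mathcal{F},\mu)$ such that: (1) if $f\in\mathbf{L}_0$, $g\in\mathbf{E}$ and $|f|\le|g|$, then $f\in\mathbf{E}$ and $\|f\|_{\mathbf{E}}\le\|g\|_{\mathbf{E}}$; (2) if $f\in\mathbf{L}_0$, $g\in\mathbf{E}$ and $\eta_{f,\mu}=\eta_{g,\mu}$, then $f\in\mathbf{E}$ and $\|f\|_{\mathbf{E}}=\|g\|_{\mathbf{E}}$. The equimeasurable standard symmetric space $\mathbf{E}(I,\mathcal{B}_m,m)$ of $\mathbf{E}(\Omega,\mathcal{F},\mu)$ is $\{g\in\mathbf{L}_0(I,\mathcal{B}_m,m):\xi_{g,m}=\xi_{f,\mu}\text{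 for some }f\in\mathbf{E}(\Omega,\mathcal{F},\mu)\}$ with $\|g\|_{\mathbf{E}(I,\mathcal{B}_m,m)}=\|f\|_{\mathbf{E}(\Omega,\mathcal{F},\mu)}$ whenever $\xi_{g,m}=\xi_{f,\mu}$, $f\in\mathbf{E}(\Omega,\mathcal{F},\mu)$. *)

theory Defs
  imports "HOL-Analysis.Analysis"
begin

section \<open>Measure spaces\<close>

definition atom :: "'a measure \<Rightarrow> 'a set \<Rightarrow> bool" where
  "atom M A \<longleftrightarrow> A \<in> sets M \<and> emeasure M A > 0 \<and>
     (\<forall>B\<in>sets M. B \<subseteq> A \<longrightarrow> emeasure M B = 0 \<or> emeasure M (A - B) = 0)"

definition nonatomic :: "'a measure \<Rightarrow> bool" where
  "nonatomic M \<longleftrightarrow> (\<nexists>A. atom M A)"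

text \<open>\<open>measure_of (space M) \<A> (emeasure M)\<close> is the restriction of the measure to the
  \<open>\<sigma>\<close>-algebra generated by \<open>\<A>\<close>.\<close>

definition separable_measure :: "'a measure \<Rightarrow> bool" where
  "separable_measure M \<longleftrightarrow>
     (\<exists>\<A>. countable \<A> \<and> algebra (space M) \<A> \<and> \<A> \<subseteq> sets M \<and>
          sets M \<subseteq> sets (completion (measure_of (space M) \<A> (emeasure M))))"

definition std_space :: "'a measure \<Rightarrow> real measure" where
  "std_space M = lebesgue_on
     (if emeasure M (space M) = \<infinity> then {0..} else {0..measure M (space M)})"


section \<open>The space of classes of measurable functions\<close>

text \<open>An element of \<open>L0 M\<close> is an equivalence class, i.e. a set of functions. Only the values on
  \<open>space M\<close> matter: functions that differ outside \<open>space M\<close> lie in the same class. All operations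
  go through a chosen representative \<open>rep\<close>; the lemmas after the definitions show that the choice
  is irrelevant.\<close>

definition cls :: "'a measure \<Rightarrow> ('a \<Rightarrow> real) \<Rightarrow> ('a \<Rightarrow> real) set" where
  "cls M f = {g \<in> borel_measurable M. AE x in M. g x = f x}"

definition L0 :: "'a measure \<Rightarrow> ('a \<Rightarrow> real) set set" where
  "L0 M = cls M ` borel_measurable M"

definition rep :: "('a \<Rightarrow> real) set \<Rightarrow> 'a \<Rightarrow> real" where
  "rep F = (SOME f. f \<in> F)"

definition L0_zero :: "'a measure \<Rightarrow> ('a \<Rightarrow> real) set" where
  "L0_zero M = cls M (\<lambda>x. 0)"

definition L0_add :: "'a measure \<Rightarrow> ('a \<Rightarrow> real) set \<Rightarrow> ('a \<Rightarrow> real) set \<Rightarrow> ('a \<Rightarrow> real) set" where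
  "L0_add M F G = cls M (\<lambda>x. rep F x + rep G x)"

definition L0_diff :: "'a measure \<Rightarrow> ('a \<Rightarrow> real) set \<Rightarrow> ('a \<Rightarrow> real) set \<Rightarrow> ('a \<Rightarrow> real) set" where
  "L0_diff M F G = cls M (\<lambda>x. rep F x - rep G x)"

definition L0_mult :: "'a measure \<Rightarrow> ('a \<Rightarrow> real) set \<Rightarrow> ('a \<Rightarrow> real) set \<Rightarrow> ('a \<Rightarrow> real) set" where
  "L0_mult M F G = cls M (\<lambda>x. rep F x * rep G x)"

definition L0_scale :: "'a measure \<Rightarrow> real \<Rightarrow> ('a \<Rightarrow> real) set \<Rightarrow> ('a \<Rightarrow> real) set" where
  "L0_scale M c F = cls M (\<lambda>x. c * rep F x)"

definition L0_abs :: "'a measure \<Rightarrow> ('a \<Rightarrow> real) set \<Rightarrow> ('a \<Rightarrow> real) set" where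
  "L0_abs M F = cls M (\<lambda>x. \<bar>rep F x\<bar>)"

definition L0_le :: "'a measure \<Rightarrow> ('a \<Rightarrow> real) set \<Rightarrow> ('a \<Rightarrow> real) set \<Rightarrow> bool" where
  "L0_le M F G \<longleftrightarrow> (AE x in M. rep F x \<le> rep G x)"

text \<open>Only meaningful for \<open>F \<ge> 0\<close>.\<close>

definition L0_nn_integral :: "'a measure \<Rightarrow> ('a \<Rightarrow> real) set \<Rightarrow> ennreal" where
  "L0_nn_integral M F = (\<integral>\<^sup>+ x. ennreal (rep F x) \<partial>M)"

lemma mem_cls_self: "f \<in> borel_measurable M \<Longrightarrow> f \<in> cls M f"
  by (simp add: cls_def)

lemma cls_eq_iff:
  assumes "f \<in> borel_measurable M" "g \<in> borel_measurable M"
  shows "cls M f = cls M g \<longleftrightarrow> (AE x in M. f x = g x)"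
proof
  assume "cls M f = cls M g"
  with mem_cls_self[OF assms(1)] show "AE x in M. f x = g x"
    by (auto simp: cls_def)
next
  assume *: "AE x in M. f x = g x"
  have "(AE x in M. h x = f x) \<longleftrightarrow> (AE x in M. h x = g x)" for h :: "'a \<Rightarrow> real"
    by (rule eventually_subst, rule eventually_mono[OF *]) simp
  then show "cls M f = cls M g" by (simp add: cls_def)
qed

lemma rep_cls:
  assumes "f \<in> borel_measurable M"
  shows rep_cls_measurable: "rep (cls M f) \<in> borel_measurable M"
    and rep_cls_AE: "AE x in M. rep (cls M f) x = f x"
proof -
  have "rep (cls M f) \<in> cls M f"
    unfolding rep_def using someI[of "\<lambda>g. g \<in> cls M f", OF mem_cls_self[OF assms]] .
  then show "rep (cls M f) \<in> borel_measurable M" "AE x in M. rep (cls M f) x = f x"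
    by (auto simp: cls_def)
qed

lemma rep_measurable: "F \<in> L0 M \<Longrightarrow> rep F \<in> borel_measurable M"
  by (auto simp: L0_def rep_cls_measurable)

lemma
  assumes [measurable]: "f \<in> borel_measurable M" "g \<in> borel_measurable M"
  shows L0_add_cls: "L0_add M (cls M f) (cls M g) = cls M (\<lambda>x. f x + g x)"
    and L0_diff_cls: "L0_diff M (cls M f) (cls M g) = cls M (\<lambda>x. f x - g x)"
    and L0_mult_cls: "L0_mult M (cls M f) (cls M g) = cls M (\<lambda>x. f x * g x)"
    and L0_scale_cls: "L0_scale M c (cls M f) = cls M (\<lambda>x. c * f x)"
    and L0_abs_cls: "L0_abs M (cls M f) = cls M (\<lambda>x. \<bar>f x\<bar>)"
    and L0_le_cls: "L0_le M (cls M f) (cls M g) \<longleftrightarrow> (AE x in M. f x \<le> g x)"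
    and L0_nn_integral_cls: "L0_nn_integral M (cls M f) = (\<integral>\<^sup>+ x. ennreal (f x) \<partial>M)"
proof -
  note [measurable] = rep_cls_measurable[OF assms(1)] rep_cls_measurable[OF assms(2)]
  note ae = rep_cls_AE[OF assms(1)] rep_cls_AE[OF assms(2)]
  show "L0_add M (cls M f) (cls M g) = cls M (\<lambda>x. f x + g x)"
    unfolding L0_add_def by (subst cls_eq_iff) (use ae in auto)
  show "L0_diff M (cls M f) (cls M g) = cls M (\<lambda>x. f x - g x)"
    unfolding L0_diff_def by (subst cls_eq_iff) (use ae in auto)
  show "L0_mult M (cls M f) (cls M g) = cls M (\<lambda>x. f x * g x)"
    unfolding L0_mult_def by (subst cls_eq_iff) (use ae in auto)
  show "L0_scale M c (cls M f) = cls M (\<lambda>x. c * f x)"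
    unfolding L0_scale_def by (subst cls_eq_iff) (use ae in auto)
  show "L0_abs M (cls M f) = cls M (\<lambda>x. \<bar>f x\<bar>)"
    unfolding L0_abs_def by (subst cls_eq_iff) (use ae in auto)
  show "L0_le M (cls M f) (cls M g) \<longleftrightarrow> (AE x in M. f x \<le> g x)"
  proof
    assume "L0_le M (cls M f) (cls M g)"
    with ae show "AE x in M. f x \<le> g x" unfolding L0_le_def by eventually_elim simp
  next
    assume "AE x in M. f x \<le> g x"
    with ae show "L0_le M (cls M f) (cls M g)" unfolding L0_le_def by eventually_elim simp
  qed
  show "L0_nn_integral M (cls M f) = (\<integral>\<^sup>+ x. ennreal (f x) \<partial>M)"
    unfolding L0_nn_integral_def by (rule nn_integral_cong_AE) (use ae in auto)
qed


section \<open>Convergence in measure on sets of finite measure\<close>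

definition L0_nbhd ::
  "'a measure \<Rightarrow> ('a \<Rightarrow> real) set \<Rightarrow> 'a set \<Rightarrow> real \<Rightarrow> ('a \<Rightarrow> real) set set" where
  "L0_nbhd M F A e =
     {G \<in> L0 M. emeasure M {x \<in> A. \<bar>rep G x - rep F x\<bar> > e} < ennreal e}"

definition L0_open :: "'a measure \<Rightarrow> ('a \<Rightarrow> real) set set \<Rightarrow> bool" where
  "L0_open M U \<longleftrightarrow> U \<subseteq> L0 M \<and>
     (\<forall>F\<in>U. \<exists>A e. A \<in> sets M \<and> emeasure M A < \<infinity> \<and> e > 0 \<and> L0_nbhd M F A e \<subseteq> U)"

definition L0_topology :: "'a measure \<Rightarrow> ('a \<Rightarrow> real) set topology" where
  "L0_topology M = topology (L0_open M)"

lemma L0_nbhd_mono: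
  assumes "F \<in> L0 M" "A \<subseteq> B" "e \<le> e'" "B \<in> sets M" "A \<in> sets M"
  shows "L0_nbhd M F B e \<subseteq> L0_nbhd M F A e'"
proof
  fix G assume "G \<in> L0_nbhd M F B e"
  then have G: "G \<in> L0 M" "emeasure M {x \<in> B. \<bar>rep G x - rep F x\<bar> > e} < ennreal e"
    by (auto simp: L0_nbhd_def)
  note [measurable] = rep_measurable[OF assms(1)] rep_measurable[OF G(1)] assms(4)
  have "B \<inter> {x \<in> space M. \<bar>rep G x - rep F x\<bar> > e} \<in> sets M" by measurable
  moreover have "B \<inter> {x \<in> space M. \<bar>rep G x - rep F x\<bar> > e} = {x \<in> B. \<bar>rep G x - rep F x\<bar> > e}"
    using sets.sets_into_space[OF assms(4)] by auto
  ultimately have "{x \<in> B. \<bar>rep G x - rep F x\<bar> > e} \<in> sets M" by simp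
  then have "emeasure M {x \<in> A. \<bar>rep G x - rep F x\<bar> > e'}
      \<le> emeasure M {x \<in> B. \<bar>rep G x - rep F x\<bar> > e}"
    using assms by (intro emeasure_mono) auto
  also have "\<dots> < ennreal e" by (fact G(2))
  also have "\<dots> \<le> ennreal e'" using assms(3) by (rule ennreal_leI)
  finally show "G \<in> L0_nbhd M F A e'" using G(1) by (simp add: L0_nbhd_def)
qed

lemma istopology_L0_open: "istopology (L0_open M)"
  unfolding istopology_def
proof (intro conjI allI impI)
  fix S T assume S: "L0_open M S" and T: "L0_open M T"
  show "L0_open M (S \<inter> T)"
    unfolding L0_open_def
  proof (intro conjI ballI)
    show "S \<inter> T \<subseteq> L0 M" using S by (auto simp: L0_open_def)
    fix F assume F: "F \<in> S \<inter> T"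
    obtain A e where A: "A \<in> sets M" "emeasure M A < \<infinity>" "e > 0" "L0_nbhd M F A e \<subseteq> S"
      using S F unfolding L0_open_def by blast
    obtain B d where B: "B \<in> sets M" "emeasure M B < \<infinity>" "d > 0" "L0_nbhd M F B d \<subseteq> T"
      using T F unfolding L0_open_def by blast
    have F': "F \<in> L0 M" using S F by (auto simp: L0_open_def)
    have "emeasure M (A \<union> B) \<le> emeasure M A + emeasure M B"
      using A(1) B(1) by (rule emeasure_subadditive)
    also have "\<dots> < \<infinity>" using A(2) B(2) by (simp add: ennreal_add_eq_top less_top)
    finally have fin: "emeasure M (A \<union> B) < \<infinity>" .
    have "L0_nbhd M F (A \<union> B) (min e d) \<subseteq> L0_nbhd M F A e"
      "L0_nbhd M F (A \<union> B) (min e d) \<subseteq> L0_nbhd M F B d"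
      using A(1) B(1) by (intro L0_nbhd_mono[OF F']; simp)+
    with A B fin show "\<exists>C c. C \<in> sets M \<and> emeasure M C < \<infinity> \<and> c > 0 \<and> L0_nbhd M F C c \<subseteq> S \<inter> T"
      by (intro exI[of _ "A \<union> B"] exI[of _ "min e d"]) auto
  qed
next
  fix \<K> assume "\<forall>K\<in>\<K>. L0_open M K"
  then show "L0_open M (\<Union>\<K>)" unfolding L0_open_def by (meson Sup_least Union_iff subset_iff)
qed

lemma openin_L0_topology: "openin (L0_topology M) U \<longleftrightarrow> L0_open M U"
  unfolding L0_topology_def by (simp add: topology_inverse'[OF istopology_L0_open])

lemma topspace_L0_topology: "topspace (L0_topology M) = L0 M"
proof -
  have "L0_open M (L0 M)"
    unfolding L0_open_def L0_nbhd_def by (auto intro!: exI[of _ "{}"] exI[of _ 1])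
  then show ?thesis
    unfolding topspace_def openin_L0_topology by (auto simp: L0_open_def)
qed


section \<open>Distribution function and decreasing rearrangement\<close>

text \<open>Both functions are only ever used at arguments \<open>x \<ge> 0\<close>. In \<open>ennreal\<close>, the infimum of the
  empty set is \<open>\<infinity>\<close>.\<close>

definition eta :: "'a measure \<Rightarrow> ('a \<Rightarrow> real) set \<Rightarrow> real \<Rightarrow> ennreal" where
  "eta M F x = emeasure M {w \<in> space M. \<bar>rep F w\<bar> > x}"

definition xi :: "'a measure \<Rightarrow> ('a \<Rightarrow> real) set \<Rightarrow> real \<Rightarrow> ennreal" where
  "xi M F x = Inf {ennreal y | y. y \<ge> 0 \<and> eta M F y \<le> ennreal x}"

definition same_eta ::
  "'a measure \<Rightarrow> ('a \<Rightarrow> real) set \<Rightarrow> 'b measure \<Rightarrow> ('b \<Rightarrow> real) set \<Rightarrow> bool" where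
  "same_eta M F N G \<longleftrightarrow> (\<forall>x\<ge>0. eta M F x = eta N G x)"

definition same_xi ::
  "'a measure \<Rightarrow> ('a \<Rightarrow> real) set \<Rightarrow> 'b measure \<Rightarrow> ('b \<Rightarrow> real) set \<Rightarrow> bool" where
  "same_xi M F N G \<longleftrightarrow> (\<forall>x\<ge>0. xi M F x = xi N G x)"

lemma eta_antimono:
  assumes "F \<in> L0 M" "x \<le> y"
  shows "eta M F y \<le> eta M F x"
proof -
  note [measurable] = rep_measurable[OF assms(1)]
  show ?thesis unfolding eta_def using assms(2) by (intro emeasure_mono) auto
qed

lemma xi_le_iff:
  assumes F: "F \<in> L0 M" and "x \<ge> 0" "y \<ge> 0"
  shows "xi M F x \<le> ennreal y \<longleftrightarrow> eta M F y \<le> ennreal x"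
proof
  assume "eta M F y \<le> ennreal x"
  then show "xi M F x \<le> ennreal y"
    unfolding xi_def using assms(3) by (intro Inf_lower) auto
next
  assume le: "xi M F x \<le> ennreal y"
  note [measurable] = rep_measurable[OF F]
  define B where "B n = {w \<in> space M. \<bar>rep F w\<bar> > y + 1 / real (Suc n)}" for n
  have B_le: "emeasure M (B n) \<le> ennreal x" for n
  proof -
    have "xi M F x < ennreal (y + 1 / real (Suc n))"
      using le by (rule order.strict_trans1) (use assms(3) in \<open>simp add: ennreal_less_iff\<close>)
    then obtain z where z: "z \<ge> 0" "eta M F z \<le> ennreal x"
        "ennreal z < ennreal (y + 1 / real (Suc n))"
      unfolding xi_def Inf_less_iff by auto
    have "z \<le> y + 1 / real (Suc n)"
      using z(1,3) by (simp add: ennreal_less_iff)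
    from eta_antimono[OF F this] z(2) show ?thesis unfolding eta_def B_def by (rule order_trans)
  qed
  have inc: "incseq B"
  proof (rule incseq_SucI, rule subsetI)
    fix n w assume "w \<in> B n"
    moreover have "1 / real (Suc (Suc n)) \<le> 1 / real (Suc n)" by (simp add: frac_le)
    ultimately show "w \<in> B (Suc n)" unfolding B_def mem_Collect_eq by linarith
  qed
  have un: "(\<Union>n. B n) = {w \<in> space M. \<bar>rep F w\<bar> > y}"
  proof (intro equalityI subsetI)
    fix w assume "w \<in> (\<Union>n. B n)"
    then obtain n where "w \<in> B n" by auto
    moreover have "1 / real (Suc n) > 0" by simp
    ultimately show "w \<in> {w \<in> space M. \<bar>rep F w\<bar> > y}" unfolding B_def mem_Collect_eq by linarith
  next
    fix w assume w: "w \<in> {w \<in> space M. \<bar>rep F w\<bar> > y}"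
    then obtain n where "inverse (real (Suc n)) < \<bar>rep F w\<bar> - y"
      using reals_Archimedean[of "\<bar>rep F w\<bar> - y"] by auto
    with w have "w \<in> B n" by (simp add: B_def inverse_eq_divide)
    then show "w \<in> (\<Union>n. B n)" by blast
  qed
  have "eta M F y = (SUP n. emeasure M (B n))"
    unfolding eta_def un[symmetric]
    by (rule SUP_emeasure_incseq[symmetric, OF _ inc]) (auto simp: B_def)
  also have "\<dots> \<le> ennreal x" using B_le by (rule SUP_least)
  finally show "eta M F y \<le> ennreal x" .
qed

lemma same_xi_imp_same_eta:
  assumes F: "F \<in> L0 M" and G: "G \<in> L0 N" and xi: "same_xi M F N G"
  shows "same_eta M F N G"
  unfolding same_eta_def
proof (intro allI impI)
  fix y :: real assume y: "y \<ge> 0"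
  have iff: "eta M F y \<le> ennreal x \<longleftrightarrow> eta N G y \<le> ennreal x" if "x \<ge> 0" for x
    using xi_le_iff[OF F that y] xi_le_iff[OF G that y] xi that by (simp add: same_xi_def)
  show "eta M F y = eta N G y"
  proof (rule antisym)
    show "eta M F y \<le> eta N G y"
      by (cases "eta N G y") (use iff in auto)
    show "eta N G y \<le> eta M F y"
      by (cases "eta M F y") (use iff in auto)
  qed
qed


section \<open>Symmetric spaces\<close>

text \<open>A quasi-norm satisfies \<open>\<parallel>f + g\<parallel> \<le> K (\<parallel>f\<parallel> + \<parallel>g\<parallel>)\<close> for some constant \<open>K \<ge> 1\<close>; Banach spaces are
  the case \<open>K = 1\<close>. The values of \<open>nrm\<close> outside \<open>E\<close> are irrelevant.\<close>

definition L0_subspace :: "'a measure \<Rightarrow> ('a \<Rightarrow> real) set set \<Rightarrow> bool" where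
  "L0_subspace M E \<longleftrightarrow> E \<subseteq> L0 M \<and> L0_zero M \<in> E \<and>
     (\<forall>F\<in>E. \<forall>G\<in>E. L0_add M F G \<in> E) \<and> (\<forall>c. \<forall>F\<in>E. L0_scale M c F \<in> E)"

definition quasi_norm ::
  "'a measure \<Rightarrow> ('a \<Rightarrow> real) set set \<Rightarrow> (('a \<Rightarrow> real) set \<Rightarrow> real) \<Rightarrow> bool" where
  "quasi_norm M E nrm \<longleftrightarrow>
     (\<forall>F\<in>E. nrm F \<ge> 0) \<and> (\<forall>F\<in>E. nrm F = 0 \<longleftrightarrow> F = L0_zero M) \<and>
     (\<forall>c. \<forall>F\<in>E. nrm (L0_scale M c F) = \<bar>c\<bar> * nrm F) \<and>
     (\<exists>K\<ge>1. \<forall>F\<in>E. \<forall>G\<in>E. nrm (L0_add M F G) \<le> K * (nrm F + nrm G))"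

definition nrm_complete ::
  "'a measure \<Rightarrow> ('a \<Rightarrow> real) set set \<Rightarrow> (('a \<Rightarrow> real) set \<Rightarrow> real) \<Rightarrow> bool" where
  "nrm_complete M E nrm \<longleftrightarrow>
     (\<forall>S :: nat \<Rightarrow> ('a \<Rightarrow> real) set. (\<forall>n. S n \<in> E) \<and>
         (\<forall>e>0. \<exists>n0. \<forall>m\<ge>n0. \<forall>n\<ge>n0. nrm (L0_diff M (S m) (S n)) < e) \<longrightarrow>
       (\<exists>F\<in>E. (\<lambda>n. nrm (L0_diff M (S n) F)) \<longlonglongrightarrow> 0))"

definition symmetric_space ::
  "'a measure \<Rightarrow> ('a \<Rightarrow> real) set set \<Rightarrow> (('a \<Rightarrow> real) set \<Rightarrow> real) \<Rightarrow> bool" where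
  "symmetric_space M E nrm \<longleftrightarrow>
     L0_subspace M E \<and> E \<noteq> {L0_zero M} \<and> quasi_norm M E nrm \<and> nrm_complete M E nrm \<and>
     (\<forall>F\<in>L0 M. \<forall>G\<in>E. L0_le M (L0_abs M F) (L0_abs M G) \<longrightarrow> F \<in> E \<and> nrm F \<le> nrm G) \<and>
     (\<forall>F\<in>L0 M. \<forall>G\<in>E. same_eta M F M G \<longrightarrow> F \<in> E \<and> nrm F = nrm G)"

definition std_sym_space :: "'a measure \<Rightarrow> ('a \<Rightarrow> real) set set \<Rightarrow> (real \<Rightarrow> real) set set" where
  "std_sym_space M E = {G \<in> L0 (std_space M). \<exists>F\<in>E. same_xi (std_space M) G M F}"

definition std_sym_norm ::
  "'a measure \<Rightarrow> ('a \<Rightarrow> real) set set \<Rightarrow> (('a \<Rightarrow> real) set \<Rightarrow> real) \<Rightarrow> (real \<Rightarrow> real) set \<Rightarrow> real" where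
  "std_sym_norm M E nrm G = (THE r. \<exists>F\<in>E. same_xi (std_space M) G M F \<and> r = nrm F)"

lemma std_sym_norm_eq:
  assumes E: "symmetric_space M E nrm" and F: "F \<in> E" and xi: "same_xi (std_space M) G M F"
  shows "std_sym_norm M E nrm G = nrm F"
  unfolding std_sym_norm_def
proof (rule the_equality)
  show "\<exists>F'\<in>E. same_xi (std_space M) G M F' \<and> nrm F = nrm F'" using F xi by blast
next
  fix r assume "\<exists>F'\<in>E. same_xi (std_space M) G M F' \<and> r = nrm F'"
  then obtain F' where F': "F' \<in> E" "same_xi (std_space M) G M F'" "r = nrm F'" by blast
  have sub: "E \<subseteq> L0 M" using E by (simp add: symmetric_space_def L0_subspace_def)
  have "same_xi M F' M F" using xi F'(2) by (simp add: same_xi_def)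
  then have "same_eta M F' M F" using F F'(1) sub by (intro same_xi_imp_same_eta) auto
  moreover have "\<forall>F'\<in>L0 M. \<forall>F\<in>E. same_eta M F' M F \<longrightarrow> F' \<in> E \<and> nrm F' = nrm F"
    using E unfolding symmetric_space_def by blast
  ultimately show "r = nrm F" using F F'(1,3) sub by blast
qed


section \<open>Isomorphisms\<close>

definition L0_algebra_iso ::
  "'a measure \<Rightarrow> 'b measure \<Rightarrow> (('a \<Rightarrow> real) set \<Rightarrow> ('b \<Rightarrow> real) set) \<Rightarrow> bool" where
  "L0_algebra_iso M N \<Phi> \<longleftrightarrow> bij_betw \<Phi> (L0 M) (L0 N) \<and>
     (\<forall>F\<in>L0 M. \<forall>G\<in>L0 M. \<Phi> (L0_add M F G) = L0_add N (\<Phi> F) (\<Phi> G)) \<and>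
     (\<forall>F\<in>L0 M. \<forall>G\<in>L0 M. \<Phi> (L0_mult M F G) = L0_mult N (\<Phi> F) (\<Phi> G)) \<and>
     (\<forall>c. \<forall>F\<in>L0 M. \<Phi> (L0_scale M c F) = L0_scale N c (\<Phi> F))"

definition L0_order_iso ::
  "'a measure \<Rightarrow> 'b measure \<Rightarrow> (('a \<Rightarrow> real) set \<Rightarrow> ('b \<Rightarrow> real) set) \<Rightarrow> bool" where
  "L0_order_iso M N \<Phi> \<longleftrightarrow> bij_betw \<Phi> (L0 M) (L0 N) \<and>
     (\<forall>F\<in>L0 M. \<forall>G\<in>L0 M. L0_le N (\<Phi> F) (\<Phi> G) \<longleftrightarrow> L0_le M F G)"

definition integral_preserving ::
  "'a measure \<Rightarrow> 'b measure \<Rightarrow> (('a \<Rightarrow> real) set \<Rightarrow> ('b \<Rightarrow> real) set) \<Rightarrow> bool" where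
  "integral_preserving M N \<Phi> \<longleftrightarrow>
     (\<forall>F\<in>L0 M. L0_le M (L0_zero M) F \<longrightarrow> L0_nn_integral N (\<Phi> F) = L0_nn_integral M F)"

definition isometric_iso ::
  "'a measure \<Rightarrow> ('a \<Rightarrow> real) set set \<Rightarrow> (('a \<Rightarrow> real) set \<Rightarrow> real) \<Rightarrow>
   'b measure \<Rightarrow> ('b \<Rightarrow> real) set set \<Rightarrow> (('b \<Rightarrow> real) set \<Rightarrow> real) \<Rightarrow>
   (('a \<Rightarrow> real) set \<Rightarrow> ('b \<Rightarrow> real) set) \<Rightarrow> bool" where
  "isometric_iso M E nrmE N D nrmD \<Phi> \<longleftrightarrow> bij_betw \<Phi> E D \<and>
     (\<forall>F\<in>E. \<forall>G\<in>E. \<Phi> (L0_add M F G) = L0_add N (\<Phi> F) (\<Phi> G)) \<and>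
     (\<forall>c. \<forall>F\<in>E. \<Phi> (L0_scale M c F) = L0_scale N c (\<Phi> F)) \<and>
     (\<forall>F\<in>E. nrmD (\<Phi> F) = nrmE F)"

end

theory Submission
  imports Defs "HOL-Probability.Distribution_Functions"
begin

text \<open>The isomorphism is composition with a measure preserving point map \<open>\<phi>\<close> from \<open>\<Omega>\<close> to \<open>I\<close> (more
  precisely its inverse). If the countable algebra is \<open>{A\<^sub>0, A\<^sub>1, \<dots>}\<close> and \<open>\<Omega>\<close> is covered by sets
  \<open>W\<^sub>k\<close> of finite measure, let \<open>g x = k + (\<Sum>n. indicator A\<^sub>n x / 4 ^ Suc n)\<close> with \<open>k\<close> least such that \<open>x \<in> W\<^sub>k\<close>.
  Every \<open>A\<^sub>n\<close> can be read off \<open>g\<close>, so \<open>g\<close> generates the \<open>\<sigma>\<close>-algebra up to null sets, and hence a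
  fibre of positive measure would be an atom. So \<open>F(t) = \<mu>(g \<le> t)\<close>, which is finite also when
  \<open>\<mu>(\<Omega>) = \<infinity>\<close>, is continuous, and \<open>\<phi> = F \<circ> g\<close> transports \<open>\<mu>\<close> to Lebesgue measure on \<open>I\<close>. It
  still generates, because \<open>{g \<le> t}\<close> and \<open>{\<phi> \<le> F(t)}\<close> agree up to a null set. Consequently every
  measurable \<open>f\<close> on \<open>\<Omega>\<close> is almost everywhere of the form \<open>h \<circ> \<phi>\<close>. Composition with \<open>\<phi>\<close> preserves
  \<open>\<eta>\<close>, and by symmetry of \<open>E\<close> the equimeasurable standard space is exactly the image of \<open>E\<close>.\<close>

section \<open>A real function generating a separable \<open>\<sigma>\<close>-algebra\<close>

definition code :: "(nat \<Rightarrow> 'a set) \<Rightarrow> 'a \<Rightarrow> real" where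
  "code A x = (\<Sum>n. indicator (A n) x / 4 ^ Suc n)"

lemma sums_quarter: "(\<lambda>n. 1 / 4 ^ Suc n :: real) sums (1 / 3)"
  using sums_mult[OF geometric_sums[of "1/4 :: real"], of "1/4"] by (simp add: power_one_over)

lemma summable_code: "summable (\<lambda>n. indicator (A n) x / 4 ^ Suc n :: real)"
  by (rule summable_comparison_test'[OF sums_summable[OF sums_quarter], of 0])
    (simp add: indicator_def divide_simps)

lemma code_nonneg: "0 \<le> code A x"
  unfolding code_def by (intro suminf_nonneg summable_code) simp

lemma code_less_1: "code A x < 1"
proof -
  have "code A x \<le> (\<Sum>n. 1 / 4 ^ Suc n)"
    unfolding code_def
    by (intro suminf_le summable_code sums_summable[OF sums_quarter])
      (simp add: indicator_def divide_simps)
  also have "\<dots> = 1 / 3" using sums_quarter by (rule sums_unique[symmetric])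
  finally show ?thesis by simp
qed

text \<open>Multiplication by 4 shifts the expansion by one place, so the leading digit splits off
  and the rest is the code of the shifted sequence; this drives the induction that reads off
  digits.\<close>

lemma code_Suc: "4 * code A x = indicator (A 0) x + code (\<lambda>n. A (Suc n)) x"
proof -
  have "code A x = indicator (A 0) x / 4 + (\<Sum>n. indicator (A (Suc n)) x / 4 ^ Suc (Suc n))"
    using suminf_split_head[OF summable_code[of A x]] by (simp add: code_def)
  also have "(\<Sum>n. indicator (A (Suc n)) x / 4 ^ Suc (Suc n) :: real)
      = code (\<lambda>n. A (Suc n)) x / 4"
    unfolding code_def
    by (subst suminf_divide[OF summable_code, symmetric]) simp
  finally show ?thesis by simp
qed

text \<open>\<open>4 * (k + code A x)\<close> is again an integer \<open>k'\<close> plus a code, where \<open>k'\<close> has the parity of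
  the digit just read; base 4 leaves room for the tail, so no carry can occur.\<close>

lemma odd_floor_code:
  "odd \<lfloor>4 ^ Suc n * (of_int k + code A x)\<rfloor> \<longleftrightarrow> x \<in> A n"
proof (induction n arbitrary: A k)
  case 0
  have "\<lfloor>4 ^ Suc 0 * (of_int k + code A x)\<rfloor> = 4 * k + (if x \<in> A 0 then 1 else 0)"
    using code_Suc[of A x] code_nonneg[of "\<lambda>n. A (Suc n)" x] code_less_1[of "\<lambda>n. A (Suc n)" x]
    by (intro floor_unique) (auto simp: indicator_def algebra_simps)
  then show ?case by auto
next
  case (Suc n)
  define k' where "k' = 4 * k + (if x \<in> A 0 then 1 else 0)"
  have "4 * (of_int k + code A x) = of_int k' + code (\<lambda>n. A (Suc n)) x"
    using code_Suc[of A x] by (auto simp: k'_def indicator_def algebra_simps)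
  then have "4 ^ Suc (Suc n) * (of_int k + code A x)
      = 4 ^ Suc n * (of_int k' + code (\<lambda>n. A (Suc n)) x)"
    by (metis mult.assoc power_Suc2)
  then show ?case using Suc.IH[of k' "\<lambda>n. A (Suc n)"] by (simp only:)
qed

lemma borel_measurable_code [measurable (raw)]:
  assumes A: "\<And>n. A n \<in> sets M"
  shows "code A \<in> borel_measurable M"
  unfolding code_def
  by (rule borel_measurable_suminf, rule borel_measurable_divide)
    (simp_all add: borel_measurable_indicator A)

text \<open>Membership in the completion gives a generated set up to a subset of a null set. That
  null set belongs to the restricted measure, hence is also null for \<open>M\<close>.\<close>

lemma separable_measure_AE_generated:
  assumes "separable_measure M"
  obtains A :: "nat \<Rightarrow> 'a set" where "range A \<subseteq> sets M"
    "\<And>B. B \<in> sets M \<Longrightarrow> \<exists>S \<in> sigma_sets (space M) (range A). AE x in M. x \<in> B \<longleftrightarrow> x \<in> S"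
proof -
  obtain \<A> where \<A>: "countable \<A>" "algebra (space M) \<A>" "\<A> \<subseteq> sets M"
      "sets M \<subseteq> sets (completion (measure_of (space M) \<A> (emeasure M)))"
    using assms unfolding separable_measure_def by blast
  define N where "N = measure_of (space M) \<A> (emeasure M)"
  have Pow: "\<A> \<subseteq> Pow (space M)" using \<A>(3) sets.sets_into_space by blast
  have sets_N: "sets N = sigma_sets (space M) \<A>" by (simp add: N_def Pow)
  have sub: "sets N \<subseteq> sets M" unfolding sets_N by (rule sets.sigma_sets_subset[OF \<A>(3)])
  \<comment> \<open>\<open>measure_of\<close> falls back to the zero measure unless its argument is
    a measure on the generated sets, so countable additivity is needed before null sets of
    \<open>N\<close> say anything about \<open>M\<close>.\<close>
  have "countably_additive (sets N) (emeasure M)"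
    by (rule countably_additiveI, rule suminf_emeasure) (use sub in blast)+
  then have emeasure_N: "emeasure N X = emeasure M X" if "X \<in> sets N" for X
    by (intro emeasure_measure_of[OF N_def Pow]) (auto simp: positive_def that)
  interpret \<A>: algebra "space M" \<A> by fact
  \<comment> \<open>An enumeration by \<open>from_nat_into\<close> has range exactly
    \<open>\<A>\<close> only for a non-empty set.\<close>
  have "{} \<in> \<A>" by (rule \<A>.empty_sets)
  then have range: "range (from_nat_into \<A>) = \<A>" by (intro range_from_nat_into \<A>(1)) auto
  show ?thesis
  proof (rule that[of "from_nat_into \<A>"])
    fix B assume "B \<in> sets M"
    then have "B \<in> sets (completion N)" using \<A>(4) by (auto simp: N_def)
    then obtain S Z Z' where B: "B = S \<union> Z" "Z \<subseteq> Z'" "Z' \<in> null_sets N" "S \<in> sets N"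
      by (rule sets_completionE)
    have "Z' \<in> null_sets M" using B(3) sub emeasure_N by (auto simp: null_sets_def)
    then have "AE x in M. x \<notin> Z'" by (rule AE_not_in)
    then have "AE x in M. x \<in> B \<longleftrightarrow> x \<in> S" by eventually_elim (use B in auto)
    then show "\<exists>S \<in> sigma_sets (space M) (range (from_nat_into \<A>)). AE x in M. x \<in> B \<longleftrightarrow> x \<in> S"
      using B(4) by (auto simp: range sets_N)
  qed (use range \<A>(3) in auto)
qed

text \<open>The code keeps the information on the \<open>A n\<close>; the added index of the first
  \<open>W i\<close> containing the point bounds each sublevel set by finitely many
  \<open>W i\<close>, which makes its measure finite.\<close>

lemma exists_AE_generating_function:
  assumes sf: "sigma_finite_measure M" and sep: "separable_measure M"
  obtains g :: "'a \<Rightarrow> real" where "g \<in> borel_measurable M" "\<And>x. 0 \<le> g x"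
    "\<And>t. emeasure M {x \<in> space M. g x \<le> t} < \<infinity>"
    "\<And>B. B \<in> sets M \<Longrightarrow> \<exists>C\<in>sets borel. AE x in M. x \<in> B \<longleftrightarrow> g x \<in> C"
proof -
  interpret sigma_finite_measure M by fact
  obtain A :: "nat \<Rightarrow> 'a set" where A: "range A \<subseteq> sets M"
    "\<And>B. B \<in> sets M \<Longrightarrow> \<exists>S \<in> sigma_sets (space M) (range A). AE x in M. x \<in> B \<longleftrightarrow> x \<in> S"
    using separable_measure_AE_generated[OF sep] by blast
  obtain W :: "nat \<Rightarrow> 'a set" where W: "range W \<subseteq> sets M" "(\<Union>i. W i) = space M"
      "\<And>i. emeasure M (W i) \<noteq> \<infinity>"
    using sigma_finite by blast
  have [measurable]: "A n \<in> sets M" "W n \<in> sets M" for n using A(1) W(1) by auto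
  define k where "k x = (LEAST i. x \<in> W i)" for x
  have [measurable]: "k \<in> measurable M (count_space UNIV)" unfolding k_def by measurable
  define g where "g x = real (k x) + code A x" for x
  have g[measurable]: "g \<in> borel_measurable M" unfolding g_def by measurable
  have finite: "emeasure M {x \<in> space M. g x \<le> t} < \<infinity>" for t
  proof -
    have "{x \<in> space M. g x \<le> t} \<subseteq> (\<Union>i\<le>nat \<lfloor>t\<rfloor>. W i)"
    proof
      fix x assume x: "x \<in> {x \<in> space M. g x \<le> t}"
      then have "\<exists>i. x \<in> W i" using W(2) by blast
      then have "x \<in> W (k x)" unfolding k_def by (rule LeastI_ex)
      moreover have "real (k x) \<le> t" using x code_nonneg[of A x] by (simp add: g_def)
      then have "k x \<le> nat \<lfloor>t\<rfloor>" by (simp add: le_nat_floor)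
      ultimately show "x \<in> (\<Union>i\<le>nat \<lfloor>t\<rfloor>. W i)" by blast
    qed
    then have "emeasure M {x \<in> space M. g x \<le> t} \<le> emeasure M (\<Union>i\<le>nat \<lfloor>t\<rfloor>. W i)"
      by (intro emeasure_mono) auto
    also have "\<dots> \<le> (\<Sum>i\<le>nat \<lfloor>t\<rfloor>. emeasure M (W i))"
      by (intro emeasure_subadditive_finite) auto
    also have "\<dots> < \<infinity>" using W(3) by (simp add: less_top[symmetric])
    finally show ?thesis .
  qed
  \<comment> \<open>Preimages of Borel sets under \<open>g\<close> form a sigma-algebra, so only the
    generators \<open>A n\<close> need checking.\<close>
  have "sigma_sets (space M) (range A) \<subseteq> sets (vimage_algebra (space M) g borel)"
  proof (rule sets.sigma_sets_subset'[where M = "vimage_algebra (space M) g borel", simplified])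
    show "range A \<subseteq> sets (vimage_algebra (space M) g borel)"
    proof safe
      fix n
      \<comment> \<open>The parity of the floor is digit \<open>n\<close>. The integer part
        \<open>k x\<close> contributes an even number after scaling by \<open>4 ^ Suc n\<close>, so
        one \<open>C\<close> serves all points.\<close>
      define C where "C = {t::real. odd \<lfloor>4 ^ Suc n * t\<rfloor>}"
      have "C \<in> sets borel" unfolding C_def by measurable
      moreover have "A n = g -` C \<inter> space M"
        using sets.sets_into_space[of "A n" M] odd_floor_code[of n "int (k _)" A]
        by (auto simp: C_def g_def)
      ultimately show "A n \<in> sets (vimage_algebra (space M) g borel)"
        by (auto intro: in_vimage_algebra)
    qed
  qed (metis sets.top space_vimage_algebra)
  then have "\<exists>C\<in>sets borel. S = g -` C \<inter> space M" if "S \<in> sigma_sets (space M) (range A)" for S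
    using that by (auto simp: sets_vimage_algebra2)
  note gen = this
  show ?thesis
  proof (rule that[OF g])
    show "0 \<le> g x" for x by (simp add: g_def code_nonneg)
    fix B assume "B \<in> sets M"
    with A(2) obtain S where S: "S \<in> sigma_sets (space M) (range A)"
      "AE x in M. x \<in> B \<longleftrightarrow> x \<in> S" by blast
    obtain C where C: "C \<in> sets borel" "S = g -` C \<inter> space M" using gen[OF S(1)] by blast
    have "AE x in M. x \<in> B \<longleftrightarrow> g x \<in> C"
      using S(2) AE_space by eventually_elim (simp add: C)
    with C(1) show "\<exists>C\<in>sets borel. AE x in M. x \<in> B \<longleftrightarrow> g x \<in> C" by blast
  qed (rule finite)
qed

section \<open>A measure preserving map to the standard space\<close>

text \<open>On a fibre \<open>g\<close> is constant, so a condition \<open>g x \<in> C\<close> holds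
  on all of it or nowhere. Every measurable subset is then null or of full measure, and a fibre of
  positive measure would be an atom.\<close>

lemma nonatomic_fibre_null:
  assumes "nonatomic M" and [measurable]: "g \<in> borel_measurable M"
    and gen: "\<And>B. B \<in> sets M \<Longrightarrow> \<exists>C\<in>sets borel. AE x in M. x \<in> B \<longleftrightarrow> g x \<in> C"
  shows "emeasure M {x \<in> space M. g x = (t::real)} = 0"
proof (rule ccontr)
  define P where "P = {x \<in> space M. g x = t}"
  have P[measurable]: "P \<in> sets M" unfolding P_def by measurable
  assume "emeasure M {x \<in> space M. g x = t} \<noteq> 0"
  then have "emeasure M P > 0" by (simp add: P_def zero_less_iff_neq_zero)
  moreover have "emeasure M B = 0 \<or> emeasure M (P - B) = 0" if B[measurable]: "B \<in> sets M" and "B \<subseteq> P" for B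
  proof -
    obtain C where C: "AE x in M. x \<in> B \<longleftrightarrow> g x \<in> C" using gen[OF B] by blast
    show ?thesis
    proof (cases "t \<in> C")
      case True
      have "AE x in M. x \<notin> P - B"
        using C by eventually_elim (use True in \<open>auto simp: P_def\<close>)
      then show ?thesis by (subst (asm) AE_iff_null_sets[symmetric]) auto
    next
      case False
      have "AE x in M. x \<notin> B"
        using C by eventually_elim (use False \<open>B \<subseteq> P\<close> in \<open>auto simp: P_def\<close>)
      then show ?thesis by (subst (asm) AE_iff_null_sets[symmetric]) auto
    qed
  qed
  ultimately have "atom M P" using P unfolding atom_def by blast
  with \<open>nonatomic M\<close> show False unfolding nonatomic_def by blast
qed

text \<open>For a finite Borel measure, the distribution function is continuous at every point
  without mass. Truncation to \<open>W\<close> reduces to that case when \<open>M\<close> is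
  infinite.\<close>

lemma isCont_distribution_function:
  fixes g :: "'a \<Rightarrow> real"
  assumes g[measurable]: "g \<in> borel_measurable M"
    and fin: "\<And>t. emeasure M {x \<in> space M. g x \<le> t} < \<infinity>"
    and null: "\<And>t. emeasure M {x \<in> space M. g x = t} = 0"
  shows "isCont (\<lambda>t. measure M {x \<in> space M. g x \<le> t}) t"
proof -
  define W where "W = {x \<in> space M. g x \<le> t + 1}"
  define \<nu> where "\<nu> = distr (restrict_space M W) borel g"
  have W[measurable]: "W \<in> sets M" unfolding W_def by measurable
  have "finite_measure (restrict_space M W)"
    using fin[of "t + 1"] by (intro finite_measureI) (simp add: emeasure_restrict_space W_def space_restrict_space Int_absorb2)
  moreover have gW: "g \<in> borel_measurable (restrict_space M W)" by (rule measurable_restrict_space1[OF g])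
  ultimately interpret \<nu>: finite_borel_measure \<nu>
    unfolding \<nu>_def finite_borel_measure_def finite_borel_measure_axioms_def
    by (auto intro: finite_measure.finite_measure_distr)
  have emeasure_\<nu>: "emeasure \<nu> B = emeasure M {x \<in> W. g x \<in> B}" if [measurable]: "B \<in> sets borel" for B
  proof -
    have "g -` B \<inter> space (restrict_space M W) = {x \<in> W. g x \<in> B}"
      by (auto simp: space_restrict_space W_def)
    then show ?thesis
      unfolding \<nu>_def by (subst emeasure_distr[OF gW that]) (auto simp: emeasure_restrict_space)
  qed
  have "measure \<nu> {t} = 0"
    using emeasure_\<nu>[of "{t}"] null[of t]
    by (simp add: measure_def W_def conj_comms cong: conj_cong)
  then have "isCont (cdf \<nu>) t" by (simp add: \<nu>.isCont_cdf)
  \<comment> \<open>Continuity is local, and the truncation at \<open>t + 1\<close> is invisible for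
    arguments below it.\<close>
  moreover have "\<forall>\<^sub>F s in nhds t. s < t + 1" using eventually_nhds_in_open[of "{..<t + 1}" t] by simp
  then have "\<forall>\<^sub>F s in nhds t. cdf \<nu> s = measure M {x \<in> space M. g x \<le> s}"
  proof eventually_elim
    case (elim s)
    then have "{x \<in> W. g x \<in> {..s}} = {x \<in> space M. g x \<le> s}" by (auto simp: W_def)
    then show ?case by (simp add: cdf_def measure_def emeasure_\<nu>)
  qed
  ultimately show ?thesis by (simp cong: isCont_cong)
qed

text \<open>This is the probability integral transform \<open>F \<circ> g\<close>, with the
  distribution function \<open>F\<close> allowed to be unbounded.\<close>

lemma exists_measure_preserving_map:
  fixes M :: "'a measure"
  assumes sf: "sigma_finite_measure M" and na: "nonatomic M" and sep: "separable_measure M"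
  obtains \<phi> :: "'a \<Rightarrow> real" where "\<phi> \<in> borel_measurable M" "\<And>x. 0 \<le> \<phi> x"
    "\<And>x. ennreal (\<phi> x) \<le> emeasure M (space M)"
    "\<And>s. 0 \<le> s \<Longrightarrow> emeasure M {x \<in> space M. \<phi> x \<le> s} = min (ennreal s) (emeasure M (space M))"
    "\<And>B. B \<in> sets M \<Longrightarrow> \<exists>C\<in>sets borel. AE x in M. x \<in> B \<longleftrightarrow> \<phi> x \<in> C"
proof -
  obtain g :: "'a \<Rightarrow> real" where g[measurable]: "g \<in> borel_measurable M" and g_nonneg: "\<And>x. 0 \<le> g x"
    and fin: "\<And>t. emeasure M {x \<in> space M. g x \<le> t} < \<infinity>"
    and gen: "\<And>B. B \<in> sets M \<Longrightarrow> \<exists>C\<in>sets borel. AE x in M. x \<in> B \<longleftrightarrow> g x \<in> C"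
    using exists_AE_generating_function[OF sf sep] by blast
  define F where "F t = measure M {x \<in> space M. g x \<le> t}" for t
  have emeasure_F: "emeasure M {x \<in> space M. g x \<le> t} = ennreal (F t)" for t
    unfolding F_def using fin[of t] by (intro emeasure_eq_ennreal_measure) auto
  have F_nonneg: "0 \<le> F t" for t by (simp add: F_def)
  have F_le: "ennreal (F t) \<le> emeasure M (space M)" for t
    unfolding emeasure_F[symmetric] by (intro emeasure_mono) auto
  have "mono F"
  proof
    fix s t :: real assume "s \<le> t"
    then have "ennreal (F s) \<le> ennreal (F t)"
      unfolding emeasure_F[symmetric] by (intro emeasure_mono) auto
    then show "F s \<le> F t" by (simp add: F_nonneg)
  qed
  have cont: "continuous_on A F" for A
    using isCont_distribution_function[OF g fin nonatomic_fibre_null[OF na g gen]]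
    unfolding F_def by (intro continuous_at_imp_continuous_on) auto
  have "\<not> g x \<le> -1" for x using g_nonneg[of x] by linarith
  \<comment> \<open>This makes the set \<open>T\<close> below non-empty for every
    \<open>s \<ge> 0\<close>.\<close>
  then have F_neg: "F (-1) = 0" by (simp add: F_def)
  define \<phi> where "\<phi> x = F (g x)" for x
  have \<phi>[measurable]: "\<phi> \<in> borel_measurable M"
    unfolding \<phi>_def using borel_measurable_mono[OF \<open>mono F\<close>] by measurable
  have distribution: "emeasure M {x \<in> space M. \<phi> x \<le> s} = min (ennreal s) (emeasure M (space M))"
    if s: "0 \<le> s" for s
  proof (cases "\<forall>t. F t \<le> s")
    case True
    have "(\<Union>n. {x \<in> space M. g x \<le> real n}) = space M" using real_arch_simple by auto
    then have "emeasure M (space M) = (SUP n. emeasure M {x \<in> space M. g x \<le> real n})"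
      by (subst SUP_emeasure_incseq) (auto simp: incseq_def)
    also have "\<dots> \<le> ennreal s"
      unfolding emeasure_F using True by (intro SUP_least ennreal_leI) auto
    finally show ?thesis using True by (simp add: \<phi>_def min_absorb2)
  next
    case False
    then obtain b where b: "s < F b" by (auto simp: not_le)
    \<comment> \<open>The aim is to rewrite \<open>\<phi> x \<le> s\<close> as
      \<open>g x \<le> Sup T\<close>, whose measure is \<open>F (Sup T)\<close>.\<close>
    define T where "T = {t. F t \<le> s}"
    have T_le: "t \<le> b" if "t \<in> T" for t
      using that b monoD[OF \<open>mono F\<close>, of b t] by (force simp: T_def)
    then have "bdd_above T" by (rule bdd_aboveI)
    moreover have "-1 \<in> T" using s F_neg by (simp add: T_def)
    moreover have "closed T" unfolding T_def by (intro closed_Collect_le cont continuous_on_const)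
    ultimately have Sup_T: "Sup T \<in> T" by (intro closed_contains_Sup) auto
    \<comment> \<open>The intermediate value theorem attains \<open>s\<close> at some
      \<open>t\<close> beyond \<open>Sup T\<close>; but such a \<open>t\<close> lies in
      \<open>T\<close>, so it is \<open>Sup T\<close> itself. Continuity, hence non-atomicity,
      enters here.\<close>
    obtain t where t: "Sup T \<le> t" "F t = s"
      using IVT'[of F "Sup T" s b] Sup_T T_le[OF Sup_T] b cont by (auto simp: T_def)
    then have "t \<le> Sup T" using \<open>bdd_above T\<close> by (intro cSup_upper) (auto simp: T_def)
    with t have F_Sup: "F (Sup T) = s" by (metis order_antisym)
    have "F u \<le> s \<longleftrightarrow> u \<le> Sup T" for u
      using cSup_upper[of u T] \<open>bdd_above T\<close> monoD[OF \<open>mono F\<close>, of u "Sup T"] F_Sup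
      by (auto simp: T_def)
    then have "emeasure M {x \<in> space M. \<phi> x \<le> s} = ennreal s"
      using emeasure_F[of "Sup T"] F_Sup by (simp add: \<phi>_def)
    moreover have "ennreal s \<le> emeasure M (space M)" using F_le[of "Sup T"] F_Sup by simp
    ultimately show ?thesis by (simp add: min_absorb1)
  qed
  \<comment> \<open>\<open>F\<close> may be constant on intervals, so \<open>\<phi>\<close> can
    merge values of \<open>g\<close>. Nothing is lost up to null sets: the two sets are nested and
    both have the finite measure \<open>F t\<close>.\<close>
  have half_line: "AE x in M. g x \<le> t \<longleftrightarrow> \<phi> x \<le> F t" for t
  proof -
    have "{x \<in> space M. g x \<le> t} \<subseteq> {x \<in> space M. \<phi> x \<le> F t}"
      using monoD[OF \<open>mono F\<close>] by (auto simp: \<phi>_def)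
    then have "emeasure M ({x \<in> space M. \<phi> x \<le> F t} - {x \<in> space M. g x \<le> t})
        = emeasure M {x \<in> space M. \<phi> x \<le> F t} - emeasure M {x \<in> space M. g x \<le> t}"
      using fin[of t] by (intro emeasure_Diff) auto
    also have "\<dots> = 0"
      using F_le[of t] by (simp add: distribution F_nonneg emeasure_F min_absorb1)
    finally have "{x \<in> space M. \<phi> x \<le> F t} - {x \<in> space M. g x \<le> t} \<in> null_sets M" by auto
    from AE_not_in[OF this] AE_space show ?thesis
      by eventually_elim (use monoD[OF \<open>mono F\<close>] in \<open>auto simp: \<phi>_def\<close>)
  qed
  \<comment> \<open>The sets \<open>C\<close> admitting such a \<open>D\<close> form a
    sigma-algebra, and half-lines belong to it by \<open>half_line\<close>.\<close>
  have transfer: "\<exists>D\<in>sets borel. AE x in M. g x \<in> C \<longleftrightarrow> \<phi> x \<in> D" if "C \<in> sets borel" for C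
  proof -
    have "C \<in> sigma_sets UNIV (range (\<lambda>t::real. {..t}))" using that by (simp add: borel_eq_atMost)
    then show ?thesis
    proof induction
      case (Basic C)
      then obtain t where "C = {..t}" by auto
      then show ?case using half_line[of t] by (intro bexI[of _ "{..F t}"]) auto
    next
      case Empty
      show ?case by (intro bexI[of _ "{}"]) auto
    next
      case (Compl C)
      then obtain D where "D \<in> sets borel" "AE x in M. g x \<in> C \<longleftrightarrow> \<phi> x \<in> D" by blast
      then show ?case by (intro bexI[of _ "- D"]) (auto simp: borel_comp)
    next
      case (Union C)
      then obtain D where D: "\<And>n. D n \<in> sets borel" "\<And>n. AE x in M. g x \<in> C n \<longleftrightarrow> \<phi> x \<in> D n"
        by metis
      from D(2) have "AE x in M. \<forall>n. g x \<in> C n \<longleftrightarrow> \<phi> x \<in> D n" by (simp add: AE_all_countable)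
      then have "AE x in M. g x \<in> (\<Union>n. C n) \<longleftrightarrow> \<phi> x \<in> (\<Union>n. D n)" by eventually_elim simp
      then show ?case using D(1) by (intro bexI[of _ "\<Union>n. D n"]) auto
    qed
  qed
  show ?thesis
  proof (rule that[OF \<phi>])
    fix B assume "B \<in> sets M"
    with gen obtain C where C: "C \<in> sets borel" "AE x in M. x \<in> B \<longleftrightarrow> g x \<in> C" by blast
    obtain D where D: "D \<in> sets borel" "AE x in M. g x \<in> C \<longleftrightarrow> \<phi> x \<in> D" using transfer[OF C(1)] by blast
    from C(2) D(2) have "AE x in M. x \<in> B \<longleftrightarrow> \<phi> x \<in> D" by eventually_elim simp
    with D(1) show "\<exists>C\<in>sets borel. AE x in M. x \<in> B \<longleftrightarrow> \<phi> x \<in> C" by blast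
  qed (use distribution F_nonneg F_le in \<open>auto simp: \<phi>_def\<close>)
qed

text \<open>A Doob-Dynkin factorization up to null sets: the rational sublevel sets of
  \<open>f\<close> come from sets \<open>C q\<close>, and \<open>f\<close> is recovered as the
  infimum of the rationals \<open>q\<close> with \<open>\<phi> x \<in> C q\<close>. Only countably
  many null sets are discarded.\<close>

lemma AE_factor_through:
  fixes f :: "'a \<Rightarrow> real"
  assumes f[measurable]: "f \<in> borel_measurable M"
    and gen: "\<And>B. B \<in> sets M \<Longrightarrow> \<exists>C\<in>sets N. AE x in M. x \<in> B \<longleftrightarrow> \<phi> x \<in> C"
  obtains h where "h \<in> borel_measurable N" "AE x in M. f x = h (\<phi> x)"
proof -
  have "\<exists>C\<in>sets N. AE x in M. f x \<le> of_rat q \<longleftrightarrow> \<phi> x \<in> C" for q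
  proof -
    have "{x \<in> space M. f x \<le> of_rat q} \<in> sets M" by measurable
    from gen[OF this] obtain C where C: "C \<in> sets N"
      "AE x in M. x \<in> {x \<in> space M. f x \<le> of_rat q} \<longleftrightarrow> \<phi> x \<in> C" by blast
    from C(2) AE_space have "AE x in M. f x \<le> of_rat q \<longleftrightarrow> \<phi> x \<in> C" by eventually_elim simp
    with C(1) show ?thesis by blast
  qed
  then obtain C where C[measurable]: "\<And>q. C q \<in> sets N"
    and AE_C: "\<And>q. AE x in M. f x \<le> of_rat q \<longleftrightarrow> \<phi> x \<in> C q" by metis
  \<comment> \<open>\<open>real_of_ereal\<close> gives 0 where the infimum is infinite; at
    \<open>\<phi> x\<close> it is the finite number \<open>f x\<close> for almost every
    \<open>x\<close>.\<close>
  define h where "h t = real_of_ereal (INF q. if t \<in> C q then ereal (of_rat q) else \<infinity>)" for t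
  have "h \<in> borel_measurable N"
    unfolding h_def by measurable
  moreover have "AE x in M. \<forall>q. f x \<le> of_rat q \<longleftrightarrow> \<phi> x \<in> C q"
    using AE_C by (simp add: AE_all_countable)
  then have "AE x in M. f x = h (\<phi> x)"
  proof eventually_elim
    case (elim x)
    have "(INF q. if \<phi> x \<in> C q then ereal (of_rat q) else \<infinity>) = ereal (f x)"
    proof (rule antisym)
      show "ereal (f x) \<le> (INF q. if \<phi> x \<in> C q then ereal (of_rat q) else \<infinity>)"
        using elim by (intro INF_greatest) auto
      show "(INF q. if \<phi> x \<in> C q then ereal (of_rat q) else \<infinity>) \<le> ereal (f x)"
      proof (rule ereal_le_epsilon2)
        fix e :: real assume "e > 0"
        then obtain q where q: "f x < of_rat q" "of_rat q < f x + e"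
          using of_rat_dense[of "f x" "f x + e"] by (metis less_add_same_cancel1)
        then have "\<phi> x \<in> C q" using elim less_imp_le by blast
        then have "(INF q. if \<phi> x \<in> C q then ereal (of_rat q) else \<infinity>) \<le> ereal (of_rat q)"
          by (intro INF_lower2[of q]) simp_all
        also have "\<dots> \<le> ereal (f x) + ereal e" using q by simp
        finally show "(INF q. if \<phi> x \<in> C q then ereal (of_rat q) else \<infinity>) \<le> ereal (f x) + ereal e" .
      qed
    qed
    then show ?case by (simp add: h_def)
  qed
  ultimately show ?thesis by (rule that)
qed

text \<open>The distribution of \<open>\<phi>\<close> is first identified on Borel sets through
  half-lines and then extended to Lebesgue sets, where completeness of \<open>M\<close> is
  essential.\<close>

lemma exists_measure_iso_std_space:
  fixes M :: "'a measure"
  assumes "complete_measure M" and sf: "sigma_finite_measure M" and na: "nonatomic M"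
    and sep: "separable_measure M"
  obtains \<phi> where "\<phi> \<in> measurable M (std_space M)" "distr M (std_space M) \<phi> = std_space M"
    "\<And>B. B \<in> sets M \<Longrightarrow> \<exists>C\<in>sets (std_space M). AE x in M. x \<in> B \<longleftrightarrow> \<phi> x \<in> C"
proof -
  interpret complete_measure M by fact
  obtain \<phi> :: "'a \<Rightarrow> real" where \<phi>[measurable]: "\<phi> \<in> borel_measurable M"
    and \<phi>_nonneg: "\<And>x. 0 \<le> \<phi> x" and \<phi>_le: "\<And>x. ennreal (\<phi> x) \<le> emeasure M (space M)"
    and \<phi>_distribution: "\<And>s. 0 \<le> s \<Longrightarrow>
      emeasure M {x \<in> space M. \<phi> x \<le> s} = min (ennreal s) (emeasure M (space M))"
    and gen: "\<And>B. B \<in> sets M \<Longrightarrow> \<exists>C\<in>sets borel. AE x in M. x \<in> B \<longleftrightarrow> \<phi> x \<in> C"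
    using exists_measure_preserving_map[OF sf na sep] by blast
  define I :: "real set" where
    "I = (if emeasure M (space M) = \<infinity> then {0..} else {0..measure M (space M)})"
  have std: "std_space M = lebesgue_on I" by (simp add: std_space_def I_def)
  have I[measurable]: "I \<in> sets borel" by (simp add: I_def)
  have \<phi>_I: "\<phi> x \<in> I" for x
    using \<phi>_nonneg[of x] \<phi>_le[of x]
    by (auto simp: I_def emeasure_eq_ennreal_measure)
  \<comment> \<open>The formula also covers negative \<open>s\<close>, since
    \<open>ennreal s\<close> is then 0.\<close>
  have I_half_line: "emeasure lborel ({..s} \<inter> I) = min (ennreal s) (emeasure M (space M))" for s
  proof (cases "0 \<le> s")
    case True
    show ?thesis
    proof (cases "emeasure M (space M) = \<infinity>")
      case inf: True
      then have "{..s} \<inter> I = {0..s}" by (auto simp: I_def)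
      with inf True show ?thesis by simp
    next
      case False
      then have "{..s} \<inter> I = {0..min s (measure M (space M))}" by (auto simp: I_def)
      with False True show ?thesis
        by (auto simp: emeasure_eq_ennreal_measure min_def ennreal_le_iff)
    qed
  next
    case False
    then have "{..s} \<inter> I = {}" by (auto simp: I_def)
    with False show ?thesis by (simp add: ennreal_neg)
  qed
  have distr_eq: "distr M borel \<phi> = density lborel (indicator I)"
  proof (rule measure_eqI_generator_eq)
    show "Int_stable (range (\<lambda>s::real. {..s}))"
      by (auto simp: Int_stable_def)
    show "emeasure (distr M borel \<phi>) X = emeasure (density lborel (indicator I)) X"
      if X_half_line: "X \<in> range (\<lambda>s::real. {..s})" for X
    proof -
      obtain s where X: "X = {..s}" using X_half_line by auto
      have "emeasure (density lborel (indicator I)) X = emeasure lborel ({..s} \<inter> I)"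
        unfolding X by (subst emeasure_density) (auto simp: indicator_inter_arith[symmetric] Int_commute)
      moreover have "emeasure (distr M borel \<phi>) X = emeasure M {x \<in> space M. \<phi> x \<le> s}"
        unfolding X by (subst emeasure_distr) (auto intro: arg_cong2[where f = emeasure])
      moreover have "emeasure M {x \<in> space M. \<phi> x \<le> s} = min (ennreal s) (emeasure M (space M))"
      proof (cases "0 \<le> s")
        case False
        then have "\<not> \<phi> x \<le> s" for x using \<phi>_nonneg[of x] by linarith
        with False show ?thesis by (simp add: ennreal_neg)
      qed (rule \<phi>_distribution)
      ultimately show ?thesis by (simp add: I_half_line)
    qed
    show "sets (distr M borel \<phi>) = sigma_sets UNIV (range (\<lambda>s::real. {..s}))"
      "sets (density lborel (indicator I)) = sigma_sets UNIV (range (\<lambda>s::real. {..s}))"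
      by (simp_all add: borel_eq_atMost)
    show "range (\<lambda>n. {..real n}) \<subseteq> range (\<lambda>s::real. {..s})" by auto
    show "(\<Union>n. {..real n}) = UNIV" using real_arch_simple by auto
    show "emeasure (distr M borel \<phi>) {..real n} \<noteq> \<infinity>" for n
    proof -
      have "emeasure (distr M borel \<phi>) {..real n} = emeasure M {x \<in> space M. \<phi> x \<le> real n}"
        by (subst emeasure_distr) (auto intro: arg_cong2[where f = emeasure])
      also have "\<dots> \<le> ennreal (real n)" by (simp add: \<phi>_distribution)
      finally show ?thesis by (auto simp: top_unique)
    qed
  qed auto
  have borel: "emeasure M (\<phi> -` B \<inter> space M) = emeasure lborel (B \<inter> I)"
    if [measurable]: "B \<in> sets borel" for B
  proof -
    have "emeasure M (\<phi> -` B \<inter> space M) = emeasure (density lborel (indicator I)) B"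
      unfolding distr_eq[symmetric] by (rule emeasure_distr[symmetric]) auto
    also have "\<dots> = emeasure lborel (B \<inter> I)"
      by (subst emeasure_density) (auto simp: indicator_inter_arith[symmetric] Int_commute)
    finally show ?thesis .
  qed
  have null: "\<phi> -` B \<inter> space M \<in> null_sets M" if "B \<in> null_sets lborel" for B
  proof -
    have "B \<inter> I \<in> null_sets lborel" using that by (rule null_set_Int2) simp
    then show ?thesis using that borel[of B] measurable_sets[OF \<phi>, of B] by (auto simp: null_sets_def)
  qed
  then have "null_sets lborel \<subseteq> null_sets (distr M lborel \<phi>)"
    using null_setsD2[of _ lborel] by (auto simp: null_sets_distr_iff)
  \<comment> \<open>A subset of a Borel null set has its preimage inside a null set of
    \<open>M\<close>, and completeness of \<open>M\<close> makes that preimage measurable.\<close>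
  then have "\<phi> \<in> measurable M lebesgue" by (intro measurable_completion2) simp_all
  then have \<phi>_std: "\<phi> \<in> measurable M (std_space M)"
    unfolding std using \<phi>_I by (intro measurable_restrict_space2) auto
  show ?thesis
  proof (rule that[OF \<phi>_std])
    show "distr M (std_space M) \<phi> = std_space M"
    proof (rule measure_eqI)
      fix B assume "B \<in> sets (distr M (std_space M) \<phi>)"
      then have B_std: "B \<in> sets (std_space M)" by simp
      then have B: "B \<in> sets lebesgue" "B \<subseteq> I" by (auto simp: std sets_restrict_space)
      \<comment> \<open>A Lebesgue set differs from a Borel set by a null set on both sides of
        \<open>\<phi>\<close>, which reduces the claim to the Borel case.\<close>
      obtain S Z Z' where S: "B = S \<union> Z" "Z \<subseteq> Z'" "Z' \<in> null_sets lborel" "S \<in> sets lborel"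
        using B(1) by (rule sets_completionE)
      have "emeasure (distr M (std_space M) \<phi>) B = emeasure M (\<phi> -` B \<inter> space M)"
        by (rule emeasure_distr[OF \<phi>_std B_std])
      also have "\<dots> = emeasure M (\<phi> -` S \<inter> space M)"
      proof (rule emeasure_eq_AE)
        show "AE x in M. x \<in> \<phi> -` B \<inter> space M \<longleftrightarrow> x \<in> \<phi> -` S \<inter> space M"
          using AE_not_in[OF null[OF S(3)]] by eventually_elim (use S in auto)
      qed (use S(4) measurable_sets[OF \<phi>_std B_std] in auto)
      also have "\<dots> = emeasure lebesgue (S \<inter> I)" using S(4) borel by simp
      also have "\<dots> = emeasure lebesgue B"
      proof (rule emeasure_eq_AE)
        show "AE x in lebesgue. x \<in> S \<inter> I \<longleftrightarrow> x \<in> B"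
          using AE_completion[OF AE_not_in[OF S(3)]] by eventually_elim (use S B(2) in auto)
      qed (use S(4) B in auto)
      also have "\<dots> = emeasure (std_space M) B"
        unfolding std using B(2) by (subst emeasure_restrict_space) auto
      finally show "emeasure (distr M (std_space M) \<phi>) B = emeasure (std_space M) B" .
    qed simp
    fix B assume "B \<in> sets M"
    with gen obtain C where C: "C \<in> sets borel" "AE x in M. x \<in> B \<longleftrightarrow> \<phi> x \<in> C" by blast
    then have "C \<inter> I \<in> sets (std_space M)"
      unfolding std by (auto simp: sets_restrict_space)
    with C(2) \<phi>_I show "\<exists>C\<in>sets (std_space M). AE x in M. x \<in> B \<longleftrightarrow> \<phi> x \<in> C"
      by (intro bexI[of _ "C \<inter> I"]) auto
  qed
qed

section \<open>Transport along a measure preserving generating map\<close>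

lemma L0E:
  assumes "F \<in> L0 M"
  obtains f where "f \<in> borel_measurable M" "F = cls M f"
  using assms by (auto simp: L0_def)

lemma cls_in_L0: "f \<in> borel_measurable M \<Longrightarrow> cls M f \<in> L0 M"
  by (simp add: L0_def)

lemma L0_zero_in_L0: "L0_zero M \<in> L0 M"
  by (simp add: L0_zero_def cls_in_L0)

lemma
  assumes "F \<in> L0 M" "G \<in> L0 M"
  shows L0_add_in_L0: "L0_add M F G \<in> L0 M"
    and L0_mult_in_L0: "L0_mult M F G \<in> L0 M"
  unfolding L0_add_def L0_mult_def
  using rep_measurable[OF assms(1)] rep_measurable[OF assms(2)]
  by (auto intro!: cls_in_L0)

lemma
  assumes "F \<in> L0 M"
  shows L0_scale_in_L0: "L0_scale M c F \<in> L0 M"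
    and L0_abs_in_L0: "L0_abs M F \<in> L0 M"
  unfolding L0_scale_def L0_abs_def using rep_measurable[OF assms] by (auto intro!: cls_in_L0)

lemmas L0_closed = L0_zero_in_L0 L0_add_in_L0 L0_mult_in_L0 L0_scale_in_L0 L0_abs_in_L0

lemma L0_subspace_diff:
  assumes E: "L0_subspace M E" and "F \<in> E" "G \<in> E"
  shows "L0_diff M F G \<in> E"
proof -
  have sub: "F \<in> L0 M" "G \<in> L0 M" using assms by (auto simp: L0_subspace_def)
  then obtain f g where f[measurable]: "f \<in> borel_measurable M" and g[measurable]: "g \<in> borel_measurable M"
    and FG: "F = cls M f" "G = cls M g" by (metis L0E)
  have "L0_diff M F G = L0_add M F (L0_scale M (-1) G)"
    by (simp add: FG L0_diff_cls L0_scale_cls[OF g g] L0_add_cls)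
  with assms show ?thesis by (simp add: L0_subspace_def)
qed

text \<open>The assumptions say that taking preimages under \<open>\<phi>\<close> is an isomorphism
  of measure algebras: \<open>distr_map\<close> gives preservation of measure and injectivity modulo
  null sets, \<open>AE_generating\<close> surjectivity. The point map itself may be neither
  injective nor surjective.\<close>

locale measure_algebra_iso =
  fixes M :: "'a measure" and N :: "'b measure" and \<phi> :: "'a \<Rightarrow> 'b"
  assumes measurable_map [measurable]: "\<phi> \<in> measurable M N"
    and distr_map: "distr M N \<phi> = N"
    and AE_generating: "\<And>B. B \<in> sets M \<Longrightarrow> \<exists>C\<in>sets N. AE x in M. x \<in> B \<longleftrightarrow> \<phi> x \<in> C"
begin

definition pull :: "('b \<Rightarrow> real) set \<Rightarrow> ('a \<Rightarrow> real) set" where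
  "pull G = cls M (\<lambda>x. rep G (\<phi> x))"

text \<open>Composition with \<open>\<phi>\<close> runs from \<open>N\<close> to \<open>M\<close>,
  so the wanted isomorphism can only be had as its inverse.\<close>

definition push :: "('a \<Rightarrow> real) set \<Rightarrow> ('b \<Rightarrow> real) set" where
  "push = inv_into (L0 N) pull"

lemma AE_map_iff: "{t \<in> space N. P t} \<in> sets N \<Longrightarrow> (AE t in N. P t) \<longleftrightarrow> (AE x in M. P (\<phi> x))"
  using AE_distr_iff[OF measurable_map, of P] unfolding distr_map .

lemma emeasure_map: "B \<in> sets N \<Longrightarrow> emeasure M (\<phi> -` B \<inter> space M) = emeasure N B"
  using emeasure_distr[OF measurable_map, of B] by (simp add: distr_map)

text \<open>The chosen representative is irrelevant because preimages of null sets of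
  \<open>N\<close> are null in \<open>M\<close>.\<close>

lemma pull_cls:
  assumes [measurable]: "h \<in> borel_measurable N"
  shows "pull (cls N h) = cls M (\<lambda>x. h (\<phi> x))"
proof -
  have [measurable]: "rep (cls N h) \<in> borel_measurable N" by (rule rep_cls_measurable) simp
  have "AE t in N. rep (cls N h) t = h t" by (rule rep_cls_AE) simp
  then have "AE x in M. rep (cls N h) (\<phi> x) = h (\<phi> x)" by (subst (asm) AE_map_iff) measurable
  then show ?thesis unfolding pull_def by (subst cls_eq_iff) auto
qed

lemma pull_in_L0: "G \<in> L0 N \<Longrightarrow> pull G \<in> L0 M"
  by (auto elim!: L0E simp: pull_cls cls_in_L0)

lemma inj_on_pull: "inj_on pull (L0 N)"
proof (rule inj_onI)
  fix G H assume "G \<in> L0 N" "H \<in> L0 N" and eq: "pull G = pull H"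
  then obtain g h where [measurable]: "g \<in> borel_measurable N" "h \<in> borel_measurable N"
    and GH: "G = cls N g" "H = cls N h" by (metis L0E)
  from eq have "AE x in M. g (\<phi> x) = h (\<phi> x)"
    by (simp add: GH pull_cls cls_eq_iff)
  then have "AE t in N. g t = h t" by (subst AE_map_iff) measurable
  then show "G = H" by (simp add: GH cls_eq_iff)
qed

text \<open>Surjectivity is the factorization of measurable functions through
  \<open>\<phi>\<close>.\<close>

lemma pull_image: "pull ` L0 N = L0 M"
proof (intro equalityI subsetI)
  fix F assume "F \<in> L0 M"
  then obtain f where f[measurable]: "f \<in> borel_measurable M" and F: "F = cls M f" by (rule L0E)
  obtain h where h[measurable]: "h \<in> borel_measurable N" "AE x in M. f x = h (\<phi> x)"
    using AE_factor_through[OF f AE_generating] by blast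
  then have "F = pull (cls N h)" by (simp add: F pull_cls cls_eq_iff)
  then show "F \<in> pull ` L0 N" by (simp add: cls_in_L0)
qed (auto simp: pull_in_L0)

lemma push_in_L0: "F \<in> L0 M \<Longrightarrow> push F \<in> L0 N"
  and pull_push: "F \<in> L0 M \<Longrightarrow> pull (push F) = F"
  unfolding push_def using inv_into_into[of F pull "L0 N"] f_inv_into_f[of F pull "L0 N"]
  by (simp_all add: pull_image)

lemma push_pull: "G \<in> L0 N \<Longrightarrow> push (pull G) = G"
  unfolding push_def by (rule inv_into_f_f[OF inj_on_pull])

lemma bij_betw_push: "bij_betw push (L0 M) (L0 N)"
  unfolding push_def by (rule bij_betw_inv_into) (simp add: bij_betw_def inj_on_pull pull_image)

section \<open>Compatibility of \<open>pull\<close> with the algebraic operations, the order and the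
  integral\<close>

lemma
  assumes "G \<in> L0 N" "H \<in> L0 N"
  shows pull_add: "pull (L0_add N G H) = L0_add M (pull G) (pull H)"
    and pull_diff: "pull (L0_diff N G H) = L0_diff M (pull G) (pull H)"
    and pull_mult: "pull (L0_mult N G H) = L0_mult M (pull G) (pull H)"
    and pull_le_iff: "L0_le M (pull G) (pull H) \<longleftrightarrow> L0_le N G H"
proof -
  obtain g h where [measurable]: "g \<in> borel_measurable N" "h \<in> borel_measurable N"
    and GH: "G = cls N g" "H = cls N h" using assms by (metis L0E)
  show "pull (L0_add N G H) = L0_add M (pull G) (pull H)"
    "pull (L0_diff N G H) = L0_diff M (pull G) (pull H)"
    "pull (L0_mult N G H) = L0_mult M (pull G) (pull H)"
    by (simp_all add: GH pull_cls L0_add_cls L0_diff_cls L0_mult_cls)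
  show "L0_le M (pull G) (pull H) \<longleftrightarrow> L0_le N G H"
    by (simp add: GH pull_cls L0_le_cls AE_map_iff)
qed

lemma
  assumes "G \<in> L0 N"
  shows pull_scale: "pull (L0_scale N c G) = L0_scale M c (pull G)"
    and pull_abs: "pull (L0_abs N G) = L0_abs M (pull G)"
    and pull_nn_integral: "L0_nn_integral M (pull G) = L0_nn_integral N G"
proof -
  obtain g where g[measurable]: "g \<in> borel_measurable N" and G: "G = cls N g"
    using assms by (rule L0E)
  have g\<phi>: "(\<lambda>x. g (\<phi> x)) \<in> borel_measurable M" by measurable
  show "pull (L0_scale N c G) = L0_scale M c (pull G)" "pull (L0_abs N G) = L0_abs M (pull G)"
    by (simp_all add: G pull_cls L0_scale_cls[OF g g] L0_scale_cls[OF g\<phi> g\<phi>]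
        L0_abs_cls[OF g g] L0_abs_cls[OF g\<phi> g\<phi>])
  show "L0_nn_integral M (pull G) = L0_nn_integral N G"
    using nn_integral_distr[OF measurable_map, of "\<lambda>t. ennreal (g t)"]
    by (simp add: G pull_cls L0_nn_integral_cls[OF g g] L0_nn_integral_cls[OF g\<phi> g\<phi>] distr_map)
qed

lemma pull_zero: "pull (L0_zero N) = L0_zero M"
  by (simp add: L0_zero_def pull_cls)

section \<open>Invariance of distribution functions and rearrangements\<close>

lemma pull_eta:
  assumes "G \<in> L0 N"
  shows "eta M (pull G) x = eta N G x"
proof -
  note [measurable] = rep_measurable[OF assms] rep_measurable[OF pull_in_L0[OF assms]]
  have "AE w in M. rep (pull G) w = rep G (\<phi> w)"
    unfolding pull_def by (rule rep_cls_AE) measurable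
  then have "eta M (pull G) x = emeasure M (\<phi> -` {t \<in> space N. \<bar>rep G t\<bar> > x} \<inter> space M)"
    unfolding eta_def using measurable_space[OF measurable_map] by (intro emeasure_eq_AE) auto
  also have "\<dots> = eta N G x" unfolding eta_def by (rule emeasure_map) measurable
  finally show ?thesis .
qed

lemma pull_same_eta_iff:
  "G \<in> L0 N \<Longrightarrow> H \<in> L0 N \<Longrightarrow> same_eta M (pull G) M (pull H) \<longleftrightarrow> same_eta N G N H"
  by (simp add: same_eta_def pull_eta)

lemma same_xi_pull: "G \<in> L0 N \<Longrightarrow> same_xi N G M (pull G)"
  by (simp add: same_xi_def xi_def pull_eta)

text \<open>The sets are matched only almost everywhere so that the lemma serves both directions of
  continuity: a given \<open>B\<close> has an exact preimage, whereas a given \<open>A\<close> is a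
  preimage only up to a null set.\<close>

lemma pull_nbhd_iff:
  assumes G: "G \<in> L0 N" and H: "H \<in> L0 N" and [measurable]: "A \<in> sets M" "B \<in> sets N"
    and AB: "AE x in M. x \<in> A \<longleftrightarrow> \<phi> x \<in> B"
  shows "pull H \<in> L0_nbhd M (pull G) A e \<longleftrightarrow> H \<in> L0_nbhd N G B e"
proof -
  note [measurable] = rep_measurable[OF G] rep_measurable[OF pull_in_L0[OF G]]
    rep_measurable[OF H] rep_measurable[OF pull_in_L0[OF H]]
  have A: "{x \<in> A. P x} = {x \<in> space M. x \<in> A \<and> P x}" for P
    using sets.sets_into_space[OF \<open>A \<in> sets M\<close>] by auto
  have B: "{x \<in> B. P x} = {x \<in> space N. x \<in> B \<and> P x}" for P
    using sets.sets_into_space[OF \<open>B \<in> sets N\<close>] by auto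
  have "AE w in M. rep (pull G) w = rep G (\<phi> w)" "AE w in M. rep (pull H) w = rep H (\<phi> w)"
    unfolding pull_def by (rule rep_cls_AE; measurable)+
  then have "emeasure M {x \<in> A. \<bar>rep (pull H) x - rep (pull G) x\<bar> > e}
      = emeasure M (\<phi> -` {t \<in> B. \<bar>rep H t - rep G t\<bar> > e} \<inter> space M)"
    unfolding A B using AB measurable_space[OF measurable_map] by (intro emeasure_eq_AE) auto
  also have "\<dots> = emeasure N {t \<in> B. \<bar>rep H t - rep G t\<bar> > e}"
    unfolding B by (rule emeasure_map) measurable
  finally show ?thesis by (simp add: L0_nbhd_def G H pull_in_L0)
qed

lemma L0_open_pull_iff:
  assumes U: "U \<subseteq> L0 N"
  shows "L0_open M (pull ` U) \<longleftrightarrow> L0_open N U"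
proof
  assume "L0_open N U"
  show "L0_open M (pull ` U)"
    unfolding L0_open_def
  proof (intro conjI ballI)
    show "pull ` U \<subseteq> L0 M" using U by (auto simp: pull_in_L0)
    fix F assume "F \<in> pull ` U"
    then obtain G where G: "G \<in> U" "F = pull G" by blast
    then obtain B e where B[measurable]: "B \<in> sets N" and "emeasure N B < \<infinity>" "e > 0" "L0_nbhd N G B e \<subseteq> U"
      using \<open>L0_open N U\<close> unfolding L0_open_def by blast
    define A where "A = \<phi> -` B \<inter> space M"
    have A: "A \<in> sets M" unfolding A_def by measurable
    have AB: "AE x in M. x \<in> A \<longleftrightarrow> \<phi> x \<in> B" by (auto simp: A_def)
    have "L0_nbhd M F A e \<subseteq> pull ` U"
    proof
      fix F' assume F': "F' \<in> L0_nbhd M F A e"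
      then have L0: "F' \<in> L0 M" by (simp add: L0_nbhd_def)
      then have "push F' \<in> L0_nbhd N G B e"
        using F' pull_nbhd_iff[OF _ push_in_L0[OF L0] A B AB, of G e] G U by (auto simp: pull_push)
      then have "push F' \<in> U" using \<open>L0_nbhd N G B e \<subseteq> U\<close> by blast
      then show "F' \<in> pull ` U" using pull_push[OF L0] by (metis imageI)
    qed
    moreover have "emeasure M A < \<infinity>" using \<open>emeasure N B < \<infinity>\<close> by (simp add: A_def emeasure_map)
    ultimately show "\<exists>A e. A \<in> sets M \<and> emeasure M A < \<infinity> \<and> e > 0 \<and> L0_nbhd M F A e \<subseteq> pull ` U"
      using A \<open>e > 0\<close> by blast
  qed
next
  assume "L0_open M (pull ` U)"
  show "L0_open N U"
    unfolding L0_open_def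
  proof (intro conjI ballI U)
    fix G assume G: "G \<in> U"
    then obtain A e where A[measurable]: "A \<in> sets M" and "emeasure M A < \<infinity>" "e > 0"
      and nbhd: "L0_nbhd M (pull G) A e \<subseteq> pull ` U"
      using \<open>L0_open M (pull ` U)\<close> unfolding L0_open_def by blast
    obtain B where B[measurable]: "B \<in> sets N" and AB: "AE x in M. x \<in> A \<longleftrightarrow> \<phi> x \<in> B"
      using AE_generating[OF A] by blast
    have "L0_nbhd N G B e \<subseteq> U"
    proof
      fix H assume H: "H \<in> L0_nbhd N G B e"
      then have L0: "H \<in> L0 N" by (simp add: L0_nbhd_def)
      then have "pull H \<in> L0_nbhd M (pull G) A e"
        using H pull_nbhd_iff[OF _ L0 A B AB, of G e] G U by auto
      then have "pull H \<in> pull ` U" using nbhd by blast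
      then show "H \<in> U" using inj_on_image_mem_iff[OF inj_on_pull L0 U] by simp
    qed
    moreover have "emeasure N B = emeasure M A"
      unfolding emeasure_map[OF B, symmetric]
      by (rule emeasure_eq_AE) (use AB in auto)
    ultimately show "\<exists>B e. B \<in> sets N \<and> emeasure N B < \<infinity> \<and> e > 0 \<and> L0_nbhd N G B e \<subseteq> U"
      using B \<open>e > 0\<close> \<open>emeasure M A < \<infinity>\<close> by metis
  qed
qed

text \<open>An injective quotient map is a homeomorphism. Since \<open>pull\<close> is onto,
  \<open>L0_open_pull_iff\<close> is the quotient condition, and the continuous inverse must agree
  with \<open>push\<close> on \<open>L0 M\<close>.\<close>

lemma homeomorphic_map_push: "homeomorphic_map (L0_topology M) (L0_topology N) push"
proof -
  have "quotient_map (L0_topology N) (L0_topology M) pull"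
    unfolding quotient_map_def topspace_L0_topology openin_L0_topology
  proof (intro conjI allI impI pull_image)
    fix U assume U: "U \<subseteq> L0 M"
    then have "pull ` {G \<in> L0 N. pull G \<in> U} = U" by (force simp: pull_image[symmetric])
    then show "L0_open N {G \<in> L0 N. pull G \<in> U} \<longleftrightarrow> L0_open M U"
      using L0_open_pull_iff[of "{G \<in> L0 N. pull G \<in> U}"] by auto
  qed
  then have "homeomorphic_map (L0_topology N) (L0_topology M) pull"
    by (simp add: homeomorphic_map_def topspace_L0_topology inj_on_pull)
  then obtain g where g: "homeomorphic_maps (L0_topology N) (L0_topology M) pull g"
    by (auto simp: homeomorphic_map_maps)
  then have "homeomorphic_map (L0_topology M) (L0_topology N) g"
    using homeomorphic_maps_sym homeomorphic_map_maps by blast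
  then show ?thesis
  proof (rule homeomorphic_map_eq)
    fix F assume "F \<in> topspace (L0_topology M)"
    then have F: "F \<in> L0 M" by (simp add: topspace_L0_topology)
    have "g (pull (push F)) = push F"
      using g push_in_L0[OF F] by (simp add: homeomorphic_maps_def topspace_L0_topology)
    then show "g F = push F" by (simp add: pull_push F)
  qed
qed

section \<open>Laws of \<open>push\<close>, read off from those of \<open>pull\<close>\<close>

lemma push_eqI: "G \<in> L0 N \<Longrightarrow> pull G = F \<Longrightarrow> push F = G"
  using push_pull by blast

lemma
  assumes "F \<in> L0 M" "G \<in> L0 M"
  shows push_add: "push (L0_add M F G) = L0_add N (push F) (push G)"
    and push_mult: "push (L0_mult M F G) = L0_mult N (push F) (push G)"
    and push_le_iff: "L0_le N (push F) (push G) \<longleftrightarrow> L0_le M F G"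
proof -
  show "push (L0_add M F G) = L0_add N (push F) (push G)"
    "push (L0_mult M F G) = L0_mult N (push F) (push G)"
    by (rule push_eqI; simp add: assms L0_closed push_in_L0 pull_add pull_mult pull_push)+
  show "L0_le N (push F) (push G) \<longleftrightarrow> L0_le M F G"
    using pull_le_iff[of "push F" "push G"] assms by (simp add: push_in_L0 pull_push)
qed

lemma
  assumes "F \<in> L0 M"
  shows push_scale: "push (L0_scale M c F) = L0_scale N c (push F)"
    and push_nn_integral: "L0_nn_integral N (push F) = L0_nn_integral M F"
proof -
  show "push (L0_scale M c F) = L0_scale N c (push F)"
    by (rule push_eqI) (simp_all add: assms L0_closed push_in_L0 pull_scale pull_push)
  show "L0_nn_integral N (push F) = L0_nn_integral M F"
    using pull_nn_integral[of "push F"] assms by (simp add: push_in_L0 pull_push)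
qed

lemma L0_algebra_iso_push: "L0_algebra_iso M N push"
  by (simp add: L0_algebra_iso_def bij_betw_push push_add push_mult push_scale)

lemma L0_order_iso_push: "L0_order_iso M N push"
  by (simp add: L0_order_iso_def bij_betw_push push_le_iff)

lemma integral_preserving_push: "integral_preserving M N push"
  by (simp add: integral_preserving_def push_nn_integral)

text \<open>Each clause for \<open>D\<close> is carried to \<open>E\<close> by \<open>pull\<close>.
  The norm \<open>nrm'\<close> is prescribed on \<open>D\<close> only, so that
  \<open>std_sym_norm\<close> can be inserted.\<close>

lemma symmetric_space_vimage_pull:
  assumes E: "symmetric_space M E nrm"
    and D: "D = {G \<in> L0 N. pull G \<in> E}" and nrm': "\<And>G. G \<in> D \<Longrightarrow> nrm' G = nrm (pull G)"
  shows "symmetric_space N D nrm'"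
proof -
  have sub: "L0_subspace M E" and nz: "E \<noteq> {L0_zero M}" and qn: "quasi_norm M E nrm"
    and compl: "nrm_complete M E nrm"
    and solid: "\<And>F G. F \<in> L0 M \<Longrightarrow> G \<in> E \<Longrightarrow> L0_le M (L0_abs M F) (L0_abs M G) \<Longrightarrow> F \<in> E \<and> nrm F \<le> nrm G"
    and symm: "\<And>F G. F \<in> L0 M \<Longrightarrow> G \<in> E \<Longrightarrow> same_eta M F M G \<Longrightarrow> F \<in> E \<and> nrm F = nrm G"
    using E unfolding symmetric_space_def by blast+
  have E_L0: "F \<in> L0 M" if "F \<in> E" for F using sub that by (auto simp: L0_subspace_def)
  have D_L0: "G \<in> L0 N" and D_E: "pull G \<in> E" if "G \<in> D" for G using that by (simp_all add: D)
  have push_D: "push F \<in> D" if "F \<in> E" for F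
    using that by (simp add: D E_L0 push_in_L0 pull_push)
  have zero_iff: "pull G = L0_zero M \<longleftrightarrow> G = L0_zero N" if "G \<in> L0 N" for G
    using inj_on_eq_iff[OF inj_on_pull that L0_zero_in_L0] by (simp add: pull_zero)
  have subN: "L0_subspace N D"
    using sub unfolding L0_subspace_def
    by (auto simp: D L0_closed pull_zero pull_add pull_scale)
  have diff_D: "L0_diff N G H \<in> D" if "G \<in> D" "H \<in> D" for G H
    by (rule L0_subspace_diff[OF subN that])
  have "D \<noteq> {L0_zero N}"
  proof
    assume *: "D = {L0_zero N}"
    have "F = L0_zero M" if "F \<in> E" for F
      using push_D[OF that] pull_push[OF E_L0[OF that]] by (simp add: * pull_zero)
    moreover have "L0_zero M \<in> E" using sub by (simp add: L0_subspace_def)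
    ultimately show False using nz by blast
  qed
  moreover have "quasi_norm N D nrm'"
    using qn subN unfolding quasi_norm_def L0_subspace_def
    by (simp add: nrm' D_E D_L0 zero_iff pull_add pull_scale) (meson D_E)
  moreover have "nrm_complete N D nrm'"
    unfolding nrm_complete_def
  proof (intro allI impI, elim conjE)
    fix S :: "nat \<Rightarrow> ('b \<Rightarrow> real) set"
    assume S: "\<forall>n. S n \<in> D"
      and cauchy: "\<forall>e>0. \<exists>n0. \<forall>m\<ge>n0. \<forall>n\<ge>n0. nrm' (L0_diff N (S m) (S n)) < e"
    have "nrm' (L0_diff N (S m) (S n)) = nrm (L0_diff M (pull (S m)) (pull (S n)))" for m n
      using S by (simp add: nrm' diff_D pull_diff D_L0)
    \<comment> \<open>The sequence carried to \<open>E\<close> is Cauchy there; the limit sought in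
      \<open>D\<close> is \<open>push F\<close>.\<close>
    with cauchy S D_E obtain F where F: "F \<in> E" "(\<lambda>n. nrm (L0_diff M (pull (S n)) F)) \<longlonglongrightarrow> 0"
      using compl[unfolded nrm_complete_def, rule_format, of "\<lambda>n. pull (S n)"] by auto
    have "nrm' (L0_diff N (S n) (push F)) = nrm (L0_diff M (pull (S n)) F)" for n
      using S push_D[OF F(1)] by (simp add: nrm' diff_D pull_diff D_L0 pull_push E_L0 F(1))
    with F push_D show "\<exists>G\<in>D. (\<lambda>n. nrm' (L0_diff N (S n) G)) \<longlonglongrightarrow> 0"
      by (intro bexI[of _ "push F"]) simp_all
  qed
  moreover have "G \<in> D \<and> nrm' G \<le> nrm' H"
    if "G \<in> L0 N" "H \<in> D" "L0_le N (L0_abs N G) (L0_abs N H)" for G H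
  proof -
    have "L0_le M (L0_abs M (pull G)) (L0_abs M (pull H))"
      using that D_L0[OF that(2)]
      by (simp add: pull_abs[symmetric] pull_le_iff L0_abs_in_L0)
    with solid[OF pull_in_L0[OF that(1)] D_E[OF that(2)]] that show ?thesis
      by (auto simp: D nrm')
  qed
  moreover have "G \<in> D \<and> nrm' G = nrm' H" if "G \<in> L0 N" "H \<in> D" "same_eta N G N H" for G H
    using symm[OF pull_in_L0[OF that(1)] D_E[OF that(2)]] that D_L0[OF that(2)]
    by (auto simp: D nrm' pull_same_eta_iff)
  ultimately show ?thesis using subN unfolding symmetric_space_def by blast
qed

end

theorem theorem3:
  fixes M :: "'a measure"
  assumes "complete_measure M"
    and "sigma_finite_measure M"
    and "nonatomic M"
    and "emeasure M (space M) > 0"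
    and "separable_measure M"
  shows "\<exists>\<Phi> :: ('a \<Rightarrow> real) set \<Rightarrow> (real \<Rightarrow> real) set.
     L0_algebra_iso M (std_space M) \<Phi> \<and>
     L0_order_iso M (std_space M) \<Phi> \<and>
     homeomorphic_map (L0_topology M) (L0_topology (std_space M)) \<Phi> \<and>
     integral_preserving M (std_space M) \<Phi> \<and>
     (\<forall>E nrm. symmetric_space M E nrm \<longrightarrow>
        symmetric_space (std_space M) (std_sym_space M E) (std_sym_norm M E nrm) \<and>
        isometric_iso M E nrm (std_space M) (std_sym_space M E) (std_sym_norm M E nrm)
          (restrict \<Phi> E))"
proof -
  let ?N = "std_space M"
  obtain \<phi> where "\<phi> \<in> measurable M ?N" "distr M ?N \<phi> = ?N"
    "\<And>B. B \<in> sets M \<Longrightarrow> \<exists>C\<in>sets ?N. AE x in M. x \<in> B \<longleftrightarrow> \<phi> x \<in> C"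
    using exists_measure_iso_std_space[OF assms(1-3,5)] by blast
  then interpret measure_algebra_iso M ?N \<phi> by unfold_locales
  have "symmetric_space ?N (std_sym_space M E) (std_sym_norm M E nrm) \<and>
      isometric_iso M E nrm ?N (std_sym_space M E) (std_sym_norm M E nrm) (restrict push E)"
    if E: "symmetric_space M E nrm" for E nrm
  proof
    have E_L0: "E \<subseteq> L0 M" and sub: "L0_subspace M E" and symm: "\<And>F G. F \<in> L0 M \<Longrightarrow> G \<in> E \<Longrightarrow> same_eta M F M G \<Longrightarrow> F \<in> E"
      using E unfolding symmetric_space_def L0_subspace_def by blast+
    \<comment> \<open>If \<open>G\<close> has the rearrangement of some \<open>F\<close> in
      \<open>E\<close>, then \<open>pull G\<close> has the distribution function of
      \<open>F\<close>, and symmetry of \<open>E\<close> puts \<open>pull G\<close> into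
      \<open>E\<close>. Conversely, \<open>pull G\<close> itself is a witness for
      \<open>G\<close>.\<close>
    have D: "std_sym_space M E = {G \<in> L0 ?N. pull G \<in> E}"
    proof (intro equalityI subsetI)
      fix G assume "G \<in> std_sym_space M E"
      then obtain F where F: "G \<in> L0 ?N" "F \<in> E" "same_xi ?N G M F" by (auto simp: std_sym_space_def)
      then have "same_eta ?N G M F" using E_L0 by (intro same_xi_imp_same_eta) auto
      then have "same_eta M (pull G) M F" by (simp add: same_eta_def pull_eta F(1))
      then show "G \<in> {G \<in> L0 ?N. pull G \<in> E}" using symm F(1,2) by (simp add: pull_in_L0)
    qed (auto simp: std_sym_space_def intro: same_xi_pull)
    have nrm: "std_sym_norm M E nrm G = nrm (pull G)" if "G \<in> std_sym_space M E" for G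
      using that by (intro std_sym_norm_eq[OF E]) (auto simp: D same_xi_pull)
    show "symmetric_space ?N (std_sym_space M E) (std_sym_norm M E nrm)"
      by (rule symmetric_space_vimage_pull[OF E D nrm])
    have "push ` E = std_sym_space M E"
      using E_L0 by (force simp: D push_in_L0 pull_push push_pull image_iff)
    moreover have "inj_on push E" using bij_betw_push E_L0 by (auto simp: bij_betw_def intro: inj_on_subset)
    ultimately have "bij_betw push E (std_sym_space M E)" by (simp add: bij_betw_def)
    moreover have "std_sym_norm M E nrm (push F) = nrm F" if "F \<in> E" for F
      using that E_L0 nrm[of "push F"] by (auto simp: D push_in_L0 pull_push subset_iff)
    moreover have "push (L0_add M F G) = L0_add ?N (push F) (push G)" if "F \<in> E" "G \<in> E" for F G
      using that E_L0 by (intro push_add) auto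
    moreover have "push (L0_scale M c F) = L0_scale ?N c (push F)" if "F \<in> E" for F c
      using that E_L0 by (intro push_scale) auto
    \<comment> \<open>\<open>restrict push E\<close> agrees with \<open>push\<close> only on
      \<open>E\<close>, so \<open>sub\<close> is used to keep sums and multiples inside
      \<open>E\<close>.\<close>
    ultimately show "isometric_iso M E nrm ?N (std_sym_space M E) (std_sym_norm M E nrm) (restrict push E)"
      using sub unfolding isometric_iso_def L0_subspace_def by (simp cong: bij_betw_cong)
  qed
  then show ?thesis
    using L0_algebra_iso_push L0_order_iso_push homeomorphic_map_push integral_preserving_push by blast
qed

end
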